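(* Every Lorentz Ricci-parallel metric nilpotent Lie algebra of type II is a double extension of a Euclidean metric Abelian Lie algebra.
   Context: A metric Lie algebra $(\mathfrak{g},\langle\cdot,\cdot\rangle)$ is a finite-dimensional real Lie algebra $\mathfrak{g}$ with a nondegenerate symmetric bilinear form; it is a metric nilpotent (resp. Abelian) Lie algebra if $\mathfrak{g}$ is nilpotent (resp. Abelian). With $n=\dim\mathfrak{g}$, it is Euclidean if the form is positive definite, and Lorentz if the form has signature $(1,n-1)$ (one minus sign and $n-1$ plus signs). Its Levi-Civita connection is the bilinear map $\nabla$ given by $2\langle\nabla_xy,z\rangle=\langle[x,y],z\rangle+\langle[z,x],y\rangle+\langle x,[z,y]\rangle$. Its curvature is $R(x,y)z=\nabla_x\nabla_yz-\nabla_y\nabla_xz-\nabla_{[x,y]}z$, its Ricci tensor is $\mathrm{ric}(x,y)=\mathrm{tr}(\xi\mapsto R(\xi,x)y)$, and its Ricci operator $\mathrm{Ric}$ is defined by $\langle\mathrm{Ric}(x),y\rangle=\mathrm{ric}(x,y)$. It is Ricci-parallel if $\nabla\mathrm{ric}=0$, i.e. $\mathrm{ric}(\nabla_xy,z)+\mathrm{ric}(y,\nabla_xz)=0$ for all $x,y,z$. A Ricci-parallel metric Lie algebra is of type II if the minimal polynomial of $\mathrm{Ric}$ is $X^2$, i.e. $\mathrm{Ric}^2=0$ but $\mathrm{Ric}\neq0$. Double extension: a metric Lie algebra $(\mathfrak{g},\langle\cdot,\cdot\rangle)$ is a double extension of a metric Lie algebra $(\mathfrak{g}_0,[\cdot,\cdot]_0,\langle\cdot,\cdot\rangle_0)$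 if there are $D,K\in\mathrm{End}(\mathfrak{g}_0)$, $L\in\mathfrak{g}_0$ such that $\mathfrak{g}=\mathbb{R}u\oplus\mathbb{R}v\oplus\mathfrak{g}_0$ as a vector space, the Lie bracket of $\mathfrak{g}$ is $$[u,e]=D(e)+\langle L,e\rangle_0v,\quad [e,e']=[e,e']_0+\langle K(e),e'\rangle_0v,\quad [\mathfrak{g},v]=0\qquad(e,e'\in\mathfrak{g}_0),$$ and the metric satisfies $\langle u,v\rangle=1$, $\langle u,u\rangle=\langle v,v\rangle=0$, $\langle u,\mathfrak{g}_0\rangle=\langle v,\mathfrak{g}_0\rangle=0$, $\langle\cdot,\cdot\rangle|_{\mathfrak{g}_0}=\langle\cdot,\cdot\rangle_0$. *)

theory Defs
  imports "HOL-Analysis.Analysis"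
begin

text \<open>
  All spaces are finite-dimensional linear subspaces \<open>V\<close> of a real vector space. Brackets, forms
  and endomorphisms are functions on the ambient type of which only the values on \<open>V\<close> matter.
\<close>

definition fin_dim_space :: "'a::real_vector set \<Rightarrow> bool" where
  "fin_dim_space V \<longleftrightarrow> (\<exists>B. finite B \<and> V = span B)"

definition linear_from :: "'a::real_vector set \<Rightarrow> ('a \<Rightarrow> 'b::real_vector) \<Rightarrow> bool" where
  "linear_from V f \<longleftrightarrow>
     (\<forall>x\<in>V. \<forall>y\<in>V. f (x + y) = f x + f y) \<and> (\<forall>c. \<forall>x\<in>V. f (c *\<^sub>R x) = c *\<^sub>R f x)"

definition endo :: "'a::real_vector set \<Rightarrow> ('a \<Rightarrow> 'a) \<Rightarrow> bool" where
  "endo V f \<longleftrightarrow> linear_from V f \<and> (\<forall>x\<in>V. f x \<in> V)"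

definition bilinear_from :: "'a::real_vector set \<Rightarrow> ('a \<Rightarrow> 'a \<Rightarrow> 'b::real_vector) \<Rightarrow> bool" where
  "bilinear_from V h \<longleftrightarrow>
     (\<forall>y\<in>V. linear_from V (\<lambda>x. h x y)) \<and> (\<forall>x\<in>V. linear_from V (\<lambda>y. h x y))"

definition basis_of :: "'a::real_vector set \<Rightarrow> 'a set \<Rightarrow> bool" where
  "basis_of V B \<longleftrightarrow> independent B \<and> span B = V"

text \<open>The trace does not depend on the basis chosen here, see \<open>trace_on_basis\<close> below.\<close>

definition trace_on :: "'a::real_vector set \<Rightarrow> ('a \<Rightarrow> 'a) \<Rightarrow> real" where
  "trace_on V f = (let B = (SOME B. basis_of V B) in \<Sum>b\<in>B. representation B (f b) b)"


locale lie_algebra =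
  fixes V :: "'a::real_vector set" and br :: "'a \<Rightarrow> 'a \<Rightarrow> 'a"
  assumes fin_dim: "fin_dim_space V"
    and br_closed: "\<And>x y. x \<in> V \<Longrightarrow> y \<in> V \<Longrightarrow> br x y \<in> V"
    and br_bilinear: "bilinear_from V br"
    and br_alternating: "\<And>x. x \<in> V \<Longrightarrow> br x x = 0"
    and jacobi: "\<And>x y z. x \<in> V \<Longrightarrow> y \<in> V \<Longrightarrow> z \<in> V \<Longrightarrow>
                   br x (br y z) + br y (br z x) + br z (br x y) = 0"

locale metric_lie_algebra = lie_algebra V br
  for V :: "'a::real_vector set" and br :: "'a \<Rightarrow> 'a \<Rightarrow> 'a" +
  fixes ip :: "'a \<Rightarrow> 'a \<Rightarrow> real"
  assumes ip_bilinear: "bilinear_from V ip"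
    and ip_sym: "\<And>x y. x \<in> V \<Longrightarrow> y \<in> V \<Longrightarrow> ip x y = ip y x"
    and ip_nondegenerate: "\<And>x. x \<in> V \<Longrightarrow> (\<forall>y\<in>V. ip x y = 0) \<Longrightarrow> x = 0"

definition abelian_lie :: "'a::real_vector set \<Rightarrow> ('a \<Rightarrow> 'a \<Rightarrow> 'a) \<Rightarrow> bool" where
  "abelian_lie V br \<longleftrightarrow> (\<forall>x\<in>V. \<forall>y\<in>V. br x y = 0)"

primrec lower_central ::
  "'a::real_vector set \<Rightarrow> ('a \<Rightarrow> 'a \<Rightarrow> 'a) \<Rightarrow> nat \<Rightarrow> 'a set" where
  "lower_central V br 0 = V"
| "lower_central V br (Suc k) = span {br x y | x y. x \<in> V \<and> y \<in> lower_central V br k}"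

definition nilpotent_lie :: "'a::real_vector set \<Rightarrow> ('a \<Rightarrow> 'a \<Rightarrow> 'a) \<Rightarrow> bool" where
  "nilpotent_lie V br \<longleftrightarrow> (\<exists>k. lower_central V br k = {0})"

definition euclidean_form :: "'a::real_vector set \<Rightarrow> ('a \<Rightarrow> 'a \<Rightarrow> real) \<Rightarrow> bool" where
  "euclidean_form V ip \<longleftrightarrow> (\<forall>x\<in>V. x \<noteq> 0 \<longrightarrow> ip x x > 0)"

text \<open>\<open>p\<close> is the number of minus signs and \<open>q\<close> the number of plus signs.\<close>

definition has_signature ::
  "'a::real_vector set \<Rightarrow> ('a \<Rightarrow> 'a \<Rightarrow> real) \<Rightarrow> nat \<Rightarrow> nat \<Rightarrow> bool" where
  "has_signature V ip p q \<longleftrightarrow>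
     (\<exists>N P. finite N \<and> finite P \<and> N \<inter> P = {} \<and> basis_of V (N \<union> P) \<and> card N = p \<and> card P = q \<and>
        (\<forall>x\<in>N. ip x x = -1) \<and> (\<forall>x\<in>P. ip x x = 1) \<and>
        (\<forall>x\<in>N \<union> P. \<forall>y\<in>N \<union> P. x \<noteq> y \<longrightarrow> ip x y = 0))"

definition lorentz_form :: "'a::real_vector set \<Rightarrow> ('a \<Rightarrow> 'a \<Rightarrow> real) \<Rightarrow> bool" where
  "lorentz_form V ip \<longleftrightarrow> dim V \<ge> 1 \<and> has_signature V ip 1 (dim V - 1)"


definition levi_civita ::
  "'a::real_vector set \<Rightarrow> ('a \<Rightarrow> 'a \<Rightarrow> 'a) \<Rightarrow> ('a \<Rightarrow> 'a \<Rightarrow> real) \<Rightarrow> 'a \<Rightarrow> 'a \<Rightarrow> 'a" where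
  "levi_civita V br ip x y =
     (THE w. w \<in> V \<and> (\<forall>z\<in>V. 2 * ip w z = ip (br x y) z + ip (br z x) y + ip x (br z y)))"

definition curvature ::
  "'a::real_vector set \<Rightarrow> ('a \<Rightarrow> 'a \<Rightarrow> 'a) \<Rightarrow> ('a \<Rightarrow> 'a \<Rightarrow> real) \<Rightarrow> 'a \<Rightarrow> 'a \<Rightarrow> 'a \<Rightarrow> 'a" where
  "curvature V br ip x y z =
     levi_civita V br ip x (levi_civita V br ip y z)
     - levi_civita V br ip y (levi_civita V br ip x z)
     - levi_civita V br ip (br x y) z"

definition ricci_tensor ::
  "'a::real_vector set \<Rightarrow> ('a \<Rightarrow> 'a \<Rightarrow> 'a) \<Rightarrow> ('a \<Rightarrow> 'a \<Rightarrow> real) \<Rightarrow> 'a \<Rightarrow> 'a \<Rightarrow> real" where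
  "ricci_tensor V br ip x y = trace_on V (\<lambda>\<xi>. curvature V br ip \<xi> x y)"

definition ricci_operator ::
  "'a::real_vector set \<Rightarrow> ('a \<Rightarrow> 'a \<Rightarrow> 'a) \<Rightarrow> ('a \<Rightarrow> 'a \<Rightarrow> real) \<Rightarrow> 'a \<Rightarrow> 'a" where
  "ricci_operator V br ip x = (THE w. w \<in> V \<and> (\<forall>y\<in>V. ip w y = ricci_tensor V br ip x y))"

definition ricci_parallel ::
  "'a::real_vector set \<Rightarrow> ('a \<Rightarrow> 'a \<Rightarrow> 'a) \<Rightarrow> ('a \<Rightarrow> 'a \<Rightarrow> real) \<Rightarrow> bool" where
  "ricci_parallel V br ip \<longleftrightarrow>
     (\<forall>x\<in>V. \<forall>y\<in>V. \<forall>z\<in>V. ricci_tensor V br ip (levi_civita V br ip x y) z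
                      + ricci_tensor V br ip y (levi_civita V br ip x z) = 0)"

definition type_II ::
  "'a::real_vector set \<Rightarrow> ('a \<Rightarrow> 'a \<Rightarrow> 'a) \<Rightarrow> ('a \<Rightarrow> 'a \<Rightarrow> real) \<Rightarrow> bool" where
  "type_II V br ip \<longleftrightarrow>
     (\<forall>x\<in>V. ricci_operator V br ip (ricci_operator V br ip x) = 0) \<and>
     (\<exists>x\<in>V. ricci_operator V br ip x \<noteq> 0)"


text \<open>
  The decomposition \<open>V = \<real>u \<oplus> \<real>v \<oplus> V0\<close> is internal: \<open>V0\<close> is a subspace of \<open>V\<close> carrying its own
  bracket \<open>br0\<close> and form \<open>ip0\<close>; \<open>V0\<close> need not be a subalgebra of \<open>V\<close>.
\<close>

definition double_extension ::
  "'a::real_vector set \<Rightarrow> ('a \<Rightarrow> 'a \<Rightarrow> 'a) \<Rightarrow> ('a \<Rightarrow> 'a \<Rightarrow> real) \<Rightarrow>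
   'a set \<Rightarrow> ('a \<Rightarrow> 'a \<Rightarrow> 'a) \<Rightarrow> ('a \<Rightarrow> 'a \<Rightarrow> real) \<Rightarrow> bool" where
  "double_extension V br ip V0 br0 ip0 \<longleftrightarrow>
     metric_lie_algebra V br ip \<and> metric_lie_algebra V0 br0 ip0 \<and>
     (\<exists>u v D K L.
        endo V0 D \<and> endo V0 K \<and> L \<in> V0 \<and>
        bij_betw (\<lambda>(a, b, e). a *\<^sub>R u + b *\<^sub>R v + e) (UNIV \<times> UNIV \<times> V0) V \<and>
        (\<forall>e\<in>V0. br u e = D e + ip0 L e *\<^sub>R v) \<and>
        (\<forall>e\<in>V0. \<forall>e'\<in>V0. br e e' = br0 e e' + ip0 (K e) e' *\<^sub>R v) \<and>
        (\<forall>x\<in>V. br x v = 0) \<and>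
        ip u v = 1 \<and> ip u u = 0 \<and> ip v v = 0 \<and>
        (\<forall>e\<in>V0. ip u e = 0 \<and> ip v e = 0) \<and>
        (\<forall>e\<in>V0. \<forall>e'\<in>V0. ip e e' = ip0 e e'))"


lemma fin_dim_space_basis:
  assumes "fin_dim_space V"
  obtains B where "basis_of V B" "finite B"
proof -
  obtain S where S: "finite S" "V = span S"
    using assms by (auto simp: fin_dim_space_def)
  obtain B where B: "B \<subseteq> S" "independent B" "S \<subseteq> span B"
    by (rule maximal_independent_subset)
  have "span B = V"
    using B S by (metis span_mono span_span subset_antisym)
  moreover have "finite B"
    using B(1) S(1) finite_subset by blast
  ultimately show thesis
    using that B(2) by (simp add: basis_of_def)
qed

lemma basis_of_finite: "fin_dim_space V \<Longrightarrow> basis_of V B \<Longrightarrow> finite B"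
  by (metis basis_of_def fin_dim_space_def independent_span_bound span_superset)

lemma linear_from_sum:
  assumes "subspace V" "linear_from V f" "finite I" "\<And>i. i \<in> I \<Longrightarrow> v i \<in> V"
  shows "f (\<Sum>i\<in>I. c i *\<^sub>R v i) = (\<Sum>i\<in>I. c i *\<^sub>R f (v i))"
  using assms(3,4)
proof (induction I rule: finite_induct)
  case empty
  have "f (0 *\<^sub>R 0) = 0 *\<^sub>R f 0"
    using assms(1,2) subspace_0 unfolding linear_from_def by blast
  thus ?case by simp
next
  case (insert i I)
  have "c i *\<^sub>R v i \<in> V" "(\<Sum>j\<in>I. c j *\<^sub>R v j) \<in> V"
    using insert assms(1) by (auto intro!: subspace_sum subspace_scale)
  thus ?case
    using insert assms(2) by (simp add: linear_from_def)
qed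

lemma trace_on_basis:
  assumes V: "fin_dim_space V" and f: "endo V f" and C: "basis_of V C"
  shows "trace_on V f = (\<Sum>c\<in>C. representation C (f c) c)"
proof -
  define B where "B = (SOME B. basis_of V B)"
  have B: "basis_of V B"
    unfolding B_def using C by (rule someI)
  have fin: "finite B" "finite C"
    using basis_of_finite V B C by blast+
  have sub: "subspace V"
    using B by (auto simp: basis_of_def)
  have BV: "independent B" "span B = V" and CV: "independent C" "span C = V"
    using B C by (auto simp: basis_of_def)
  have inV: "b \<in> V" if "b \<in> B \<union> C" for b
    using that BV CV span_base by blast
  have fV: "f x \<in> V" if "x \<in> V" for x
    using that f by (simp add: endo_def)
  have 1: "representation B (f b) b = (\<Sum>c\<in>C. representation C b c * representation B (f c) b)"
    if b: "b \<in> B" for b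
  proof -
    have "f b = f (\<Sum>c\<in>C. representation C b c *\<^sub>R c)"
      using sum_representation_eq[of C b C] CV fin inV b by simp
    also have "\<dots> = (\<Sum>c\<in>C. representation C b c *\<^sub>R f c)"
      using f sub fin inV by (intro linear_from_sum[of V]) (auto simp: endo_def)
    finally have "representation B (f b) b
        = (\<Sum>c\<in>C. representation B (representation C b c *\<^sub>R f c) b)"
      using BV sub fV inV by (simp add: representation_sum subspace_scale)
    also have "\<dots> = (\<Sum>c\<in>C. representation C b c * representation B (f c) b)"
      using BV fV inV by (intro sum.cong) (auto simp: representation_scale)
    finally show ?thesis .
  qed
  have 2: "representation C (f c) c = (\<Sum>b\<in>B. representation C b c * representation B (f c) b)"
    if c: "c \<in> C" for c
  proof -
    have "f c = (\<Sum>b\<in>B. representation B (f c) b *\<^sub>R b)"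
      using sum_representation_eq[of B "f c" B] BV fin inV fV c by simp
    hence "representation C (f c) c
        = representation C (\<Sum>b\<in>B. representation B (f c) b *\<^sub>R b) c"
      by simp
    also have "\<dots> = (\<Sum>b\<in>B. representation C (representation B (f c) b *\<^sub>R b) c)"
      using CV sub inV by (simp add: representation_sum subspace_scale)
    also have "\<dots> = (\<Sum>b\<in>B. representation C b c * representation B (f c) b)"
      using CV inV by (intro sum.cong) (auto simp: representation_scale)
    finally show ?thesis .
  qed
  have "trace_on V f = (\<Sum>b\<in>B. representation B (f b) b)"
    by (simp add: trace_on_def B_def Let_def)
  also have "\<dots> = (\<Sum>c\<in>C. \<Sum>b\<in>B. representation C b c * representation B (f c) b)"
    using 1 by (simp add: sum.swap[of _ C B])
  also have "\<dots> = (\<Sum>c\<in>C. representation C (f c) c)"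
    using 2 by simp
  finally show ?thesis .
qed

text \<open>
  Existence and uniqueness of the vectors picked out by \<open>THE\<close> in \<open>levi_civita\<close> and
  \<open>ricci_operator\<close>.
\<close>

lemma (in metric_lie_algebra) riesz:
  assumes phi: "linear_from V \<phi>"
  shows "\<exists>!w. w \<in> V \<and> (\<forall>z\<in>V. ip w z = \<phi> z)"
proof -
  obtain B where B: "basis_of V B" and fin: "finite B"
    using fin_dim fin_dim_space_basis by blast
  have BV: "independent B" "span B = V" and sub: "subspace V"
    using B by (auto simp: basis_of_def)
  have inV: "b \<in> V" if "b \<in> B" for b
    using that BV span_base by blast
  have lin1: "linear_from V (\<lambda>x. ip x y)" and lin2: "linear_from V (\<lambda>x. ip y x)"
    if "y \<in> V" for y
    using ip_bilinear that by (auto simp: bilinear_from_def)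
  have eq_on_basis: "\<forall>z\<in>V. p z = q z"
    if p: "linear_from V p" and q: "linear_from V q" and pq: "\<forall>b\<in>B. p b = q b"
    for p q :: "'a \<Rightarrow> real"
  proof
    fix z assume "z \<in> V"
    hence z: "z = (\<Sum>b\<in>B. representation B z b *\<^sub>R b)"
      using sum_representation_eq[of B z B] BV fin by simp
    have "p (\<Sum>b\<in>B. representation B z b *\<^sub>R b) = q (\<Sum>b\<in>B. representation B z b *\<^sub>R b)"
      using linear_from_sum[OF sub p fin inV] linear_from_sum[OF sub q fin inV] pq by simp
    thus "p z = q z" using z by simp
  qed
  obtain g where g: "linear g" "\<forall>b\<in>B. g b = (\<Sum>c\<in>B. ip b c *\<^sub>R c)"
    using linear_independent_extend[OF BV(1), of "\<lambda>b. \<Sum>c\<in>B. ip b c *\<^sub>R c"] by blast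
  have g_eq: "g x = (\<Sum>c\<in>B. ip x c *\<^sub>R c)" if x: "x \<in> V" for x
  proof -
    have x': "x = (\<Sum>b\<in>B. representation B x b *\<^sub>R b)"
      using sum_representation_eq[of B x B] BV fin x by simp
    have "g x = g (\<Sum>b\<in>B. representation B x b *\<^sub>R b)" using x' by simp
    also have "\<dots> = (\<Sum>b\<in>B. representation B x b *\<^sub>R (\<Sum>c\<in>B. ip b c *\<^sub>R c))"
      using g by (simp add: linear_sum linear_scale)
    also have "\<dots> = (\<Sum>b\<in>B. \<Sum>c\<in>B. (representation B x b * ip b c) *\<^sub>R c)"
      by (simp add: scaleR_sum_right)
    also have "\<dots> = (\<Sum>c\<in>B. \<Sum>b\<in>B. (representation B x b * ip b c) *\<^sub>R c)"
      by (rule sum.swap)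
    also have "\<dots> = (\<Sum>c\<in>B. ip (\<Sum>b\<in>B. representation B x b *\<^sub>R b) c *\<^sub>R c)"
    proof (rule sum.cong[OF refl])
      fix c assume "c \<in> B"
      hence "ip (\<Sum>b\<in>B. representation B x b *\<^sub>R b) c
          = (\<Sum>b\<in>B. representation B x b *\<^sub>R ip b c)"
        using linear_from_sum[OF sub lin1 fin, of c "\<lambda>b. b"] inV by blast
      thus "(\<Sum>b\<in>B. (representation B x b * ip b c) *\<^sub>R c)
          = ip (\<Sum>b\<in>B. representation B x b *\<^sub>R b) c *\<^sub>R c"
        by (simp add: scaleR_sum_left)
    qed
    finally show ?thesis using x' by simp
  qed
  have coeffs: "\<forall>c\<in>B. p c = q c"
    if "(\<Sum>c\<in>B. p c *\<^sub>R c) = (\<Sum>c\<in>B. q c *\<^sub>R c)" for p q :: "'a \<Rightarrow> real"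
  proof -
    have "(\<Sum>c\<in>B. (p c - q c) *\<^sub>R c) = 0"
      using that by (simp add: scaleR_left_diff_distrib sum_subtractf)
    thus ?thesis
      using independentD[OF BV(1) fin order_refl, of "\<lambda>c. p c - q c"] by auto
  qed
  have inj: "inj_on g V"
  proof (rule inj_onI)
    fix x y assume xy: "x \<in> V" "y \<in> V" "g x = g y"
    have "\<forall>c\<in>B. ip x c = ip y c"
      by (rule coeffs) (use g_eq xy in auto)
    hence eq: "\<forall>z\<in>V. ip x z = ip y z"
      using eq_on_basis[OF lin2[OF xy(1)] lin2[OF xy(2)]] by simp
    have "x - y \<in> V" using xy sub by (simp add: subspace_diff)
    moreover have "\<forall>z\<in>V. ip (x - y) z = 0"
    proof
      fix z assume z: "z \<in> V"
      have "ip ((x - y) + y) z = ip (x - y) z + ip y z"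
        using lin1[OF z] \<open>x - y \<in> V\<close> xy unfolding linear_from_def by blast
      thus "ip (x - y) z = 0" using eq z by simp
    qed
    ultimately show "x = y" using ip_nondegenerate by fastforce
  qed
  have ind: "independent (g ` B)"
    using linear_independent_injective_image[OF g(1) BV(1)] inj BV by simp
  have card: "card (g ` B) = card B"
    using inV by (intro card_image inj_on_subset[OF inj]) auto
  have gV: "g ` B \<subseteq> V"
    using g_eq inV sub by (auto intro!: subspace_sum subspace_scale)
  have surj: "v \<in> span (g ` B)" if v: "v \<in> V" for v
  proof (rule ccontr)
    assume n: "v \<notin> span (g ` B)"
    hence "independent (insert v (g ` B))" using ind by (simp add: independent_insert)
    moreover have "insert v (g ` B) \<subseteq> span B" using v gV BV by simp
    ultimately have "card (insert v (g ` B)) \<le> card B" using independent_span_bound fin by blast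
    moreover have "v \<notin> g ` B" using n span_base[of v "g ` B"] by argo
    ultimately show False using card fin by (simp add: card_insert_if)
  qed
  have "(\<Sum>c\<in>B. \<phi> c *\<^sub>R c) \<in> V"
    using inV sub by (auto intro!: subspace_sum subspace_scale)
  hence "(\<Sum>c\<in>B. \<phi> c *\<^sub>R c) \<in> g ` V"
    using surj linear_span_image[OF g(1), of B] BV(2) by metis
  then obtain w where w: "w \<in> V" "g w = (\<Sum>c\<in>B. \<phi> c *\<^sub>R c)" by (metis imageE)
  have "\<forall>c\<in>B. ip w c = \<phi> c"
    by (rule coeffs) (use g_eq w in auto)
  hence ipw: "\<forall>z\<in>V. ip w z = \<phi> z" using eq_on_basis[OF lin2[OF w(1)] phi] by simp
  show ?thesis
  proof (rule ex1I[of _ w])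
    show "w \<in> V \<and> (\<forall>z\<in>V. ip w z = \<phi> z)" using w(1) ipw by simp
    fix w' assume w': "w' \<in> V \<and> (\<forall>z\<in>V. ip w' z = \<phi> z)"
    hence "g w' = g w" using g_eq w(1) ipw inV by simp
    thus "w' = w" using inj w' w(1) by (simp add: inj_on_def)
  qed
qed

lemma (in metric_lie_algebra) levi_civita_koszul:
  assumes x: "x \<in> V" and y: "y \<in> V"
  shows "levi_civita V br ip x y \<in> V"
    and "\<And>z. z \<in> V \<Longrightarrow> 2 * ip (levi_civita V br ip x y) z
           = ip (br x y) z + ip (br z x) y + ip x (br z y)"
proof -
  let ?r = "\<lambda>z. ip (br x y) z + ip (br z x) y + ip x (br z y)"
  have "linear_from V (\<lambda>z. ?r z / 2)"
    using ip_bilinear br_bilinear x y br_closed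
    by (simp add: linear_from_def bilinear_from_def field_simps)
  from riesz[OF this] have "\<exists>!w. w \<in> V \<and> (\<forall>z\<in>V. 2 * ip w z = ?r z)"
    by (simp add: field_simps)
  from theI'[OF this] show "levi_civita V br ip x y \<in> V"
    "\<And>z. z \<in> V \<Longrightarrow> 2 * ip (levi_civita V br ip x y) z = ?r z"
    unfolding levi_civita_def by blast+
qed

end

theory Submission
  imports Defs
begin

text \<open>
  The Ricci operator is self-adjoint with square zero, so its image is totally isotropic; in Lorentz
  signature it is a line \<open>\<real>v\<close> with \<open>v\<close> null, and \<open>ric(x,y) = c\<langle>x,v\<rangle>\<langle>y,v\<rangle>\<close> with \<open>c \<noteq> 0\<close>. Since
  \<open>ric\<close> is parallel, so is \<open>v\<close>. The Koszul formula splits \<open>\<nabla>v = 0\<close> into its symmetric and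
  antisymmetric parts: \<open>ad v\<close> is skew and \<open>v\<close> is orthogonal to all brackets. Being also nilpotent,
  \<open>ad v\<close> vanishes, so \<open>v\<close> is central. On the Euclidean quotient of \<open>v\<^sup>\<bottom>\<close> by \<open>\<real>v\<close> the Ricci tensor is
  zero; its trace is a negative multiple of the sum of the squares of the structure constants, because
  adjoint maps and their squares are nilpotent and hence traceless. So brackets of elements
  of \<open>v\<^sup>\<bottom>\<close> lie in \<open>\<real>v\<close>, and a complement of \<open>\<real>v\<close> in \<open>v\<^sup>\<bottom>\<close> is the Abelian Euclidean algebra sought.
\<close>

section \<open>Nilpotent endomorphisms\<close>

lemma subspace_image_endo:
  assumes W: "subspace W" and f: "endo W f"
  shows "subspace (f ` W)"
  unfolding subspace_def
proof (intro conjI ballI allI)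
  have "f (0 *\<^sub>R 0) = 0 *\<^sub>R f 0"
    using f subspace_0[OF W] unfolding endo_def linear_from_def by blast
  thus "0 \<in> f ` W"
    using subspace_0[OF W] by (metis image_eqI scale_zero_left)
next
  fix x y assume "x \<in> f ` W" "y \<in> f ` W"
  then obtain a b where ab: "a \<in> W" "b \<in> W" "x = f a" "y = f b" by blast
  hence "x + y = f (a + b)" using f by (simp add: endo_def linear_from_def)
  thus "x + y \<in> f ` W" using ab subspace_add[OF W] by blast
next
  fix c x assume "x \<in> f ` W"
  then obtain a where a: "a \<in> W" "x = f a" by blast
  hence "c *\<^sub>R x = f (c *\<^sub>R a)" using f by (simp add: endo_def linear_from_def)
  thus "c *\<^sub>R x \<in> f ` W" using a subspace_scale[OF W] by blast
qed

text \<open>Induction on the exponent: a basis of the image, where one power fewer suffices, is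
  extended to \<open>W\<close>, and every added vector is sent into the span of the old ones. The
  condition on \<open>span (B - {b})\<close> expresses a zero diagonal without ordering the
  basis.\<close>

lemma nilpotent_endo_basis:
  assumes "subspace W" "endo W f" "\<And>x. x \<in> W \<Longrightarrow> (f ^^ k) x = 0"
  shows "\<exists>B. basis_of W B \<and> (\<forall>b\<in>B. f b \<in> span (B - {b}))"
  using assms
proof (induction k arbitrary: W)
  case 0
  have "W = {0}" using 0(3) subspace_0[OF 0(1)] by auto
  hence "basis_of W {}" by (simp add: basis_of_def independent_empty)
  thus ?case by blast
next
  case (Suc k)
  have sub: "subspace (f ` W)" and fW: "f ` W \<subseteq> W"
    using subspace_image_endo Suc.prems by (auto simp: endo_def)
  have "endo (f ` W) f"
    using Suc.prems(2) unfolding endo_def linear_from_def by blast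
  moreover have "(f ^^ k) x = 0" if "x \<in> f ` W" for x
    using that Suc.prems(3) by (auto simp: funpow_swap1)
  ultimately obtain B' where B': "basis_of (f ` W) B'" "\<forall>b\<in>B'. f b \<in> span (B' - {b})"
    using Suc.IH[OF sub] by blast
  have B'W: "B' \<subseteq> W" "independent B'" "span B' = f ` W"
    using B'(1) fW span_superset[of B'] by (auto simp: basis_of_def)
  obtain B where B: "B' \<subseteq> B" "B \<subseteq> W" "independent B" "W \<subseteq> span B"
    using maximal_independent_subset_extend[OF B'W(1,2)] by blast
  have "span B = W"
    using B span_minimal[OF B(2) Suc.prems(1)] by blast
  moreover have "f b \<in> span (B - {b})" if b: "b \<in> B" for b
  proof (cases "b \<in> B'")
    case True
    thus ?thesis using B'(2) span_mono[of "B' - {b}" "B - {b}"] B(1) by blast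
  next
    case False
    hence "span B' \<subseteq> span (B - {b})" using B(1) by (intro span_mono) blast
    thus ?thesis using b B(2) B'W(3) by blast
  qed
  ultimately show ?case using B(3) by (auto simp: basis_of_def)
qed

lemma trace_on_nilpotent:
  assumes V: "fin_dim_space V" and f: "endo V f" and nil: "\<And>x. x \<in> V \<Longrightarrow> (f ^^ k) x = 0"
  shows "trace_on V f = 0"
proof -
  have "subspace V" using V by (auto simp: fin_dim_space_def)
  from nilpotent_endo_basis[OF this f nil] obtain B
    where B: "basis_of V B" "\<And>b. b \<in> B \<Longrightarrow> f b \<in> span (B - {b})" by blast
  have "representation B (f b) b = 0" if b: "b \<in> B" for b
  proof -
    have ind: "independent B" using B(1) by (simp add: basis_of_def)
    have "representation B (f b) = representation (B - {b}) (f b)"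
      by (rule representation_extend[OF ind B(2)[OF b]]) blast
    thus ?thesis using representation_ne_zero[of "B - {b}" "f b" b] by auto
  qed
  thus ?thesis using trace_on_basis[OF V f B(1)] by simp
qed

section \<open>Structure constants\<close>

text \<open>
  The scalar curvature identity of a unimodular Euclidean Lie algebra with vanishing Killing form,
  in terms of the structure constants \<open>c\<close>: all cross terms are traces of squares of adjoint maps,
  so that only a negative multiple of the sum of the squares of the structure constants survives.
\<close>

lemma structure_constants_eq_0:
  fixes c :: "'b \<Rightarrow> 'b \<Rightarrow> 'b \<Rightarrow> real"
  assumes fin: "finite E"
    and anti: "\<And>i j k. i \<in> E \<Longrightarrow> j \<in> E \<Longrightarrow> k \<in> E \<Longrightarrow> c j i k = - c i j k"
    and uni: "\<And>l. l \<in> E \<Longrightarrow> (\<Sum>k\<in>E. c l k k) = 0"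
    and kil: "\<And>i. i \<in> E \<Longrightarrow> (\<Sum>j\<in>E. \<Sum>k\<in>E. c i j k * c i k j) = 0"
    and g: "\<And>i j k. i \<in> E \<Longrightarrow> j \<in> E \<Longrightarrow> k \<in> E \<Longrightarrow> 2 * g i j k = c i j k + c k i j + c k j i"
    and scal: "(\<Sum>i\<in>E. \<Sum>k\<in>E. \<Sum>l\<in>E. g i k l * g k i l - g k k l * g i i l - c i k l * g l k i) = 0"
    and ijk: "i \<in> E" "j \<in> E" "k \<in> E"
  shows "c i j k = 0"
proof -
  let ?S = "\<lambda>F::'b \<Rightarrow> 'b \<Rightarrow> 'b \<Rightarrow> real. \<Sum>i\<in>E. \<Sum>k\<in>E. \<Sum>l\<in>E. F i k l"
  \<comment> \<open>All three indices range over \<open>E\<close>, so permuting the slots of the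
    summand preserves the triple sum.\<close>
  have inner: "?S (\<lambda>i k l. F i l k) = ?S F" for F
    by (rule sum.cong[OF refl]) (rule sum.swap)
  have swap: "?S (\<lambda>i k l. F k i l) = ?S F" for F by (rule sum.swap)
  have rot: "?S (\<lambda>i k l. F l i k) = ?S F" for F
    using inner[of "\<lambda>i k l. F k i l"] swap[of F] by (rule trans)
  have flip: "?S (\<lambda>i k l. F l k i) = ?S F" for F
    using rot[of "\<lambda>i k l. F i l k"] inner[of F] by (rule trans)
  \<comment> \<open>Write a, b, d for \<open>c i k l\<close>, \<open>c l i k\<close>,
    \<open>c l k i\<close>. Their squares have the same total, while the mixed products are, up to
    sign and reindexing, the vanishing sums of \<open>kil\<close>.\<close>
  let ?sq = "?S (\<lambda>i k l. (c i k l)\<^sup>2)"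
  have b2: "?S (\<lambda>i k l. (c l i k)\<^sup>2) = ?sq" by (rule rot[of "\<lambda>i k l. (c i k l)\<^sup>2"])
  have d2: "?S (\<lambda>i k l. (c l k i)\<^sup>2) = ?sq" by (rule flip[of "\<lambda>i k l. (c i k l)\<^sup>2"])
  have K: "?S (\<lambda>i k l. c i k l * c i l k) = 0" using kil by simp
  have bd: "?S (\<lambda>i k l. c l i k * c l k i) = 0"
    using rot[of "\<lambda>i k l. c i k l * c i l k"] K by simp
  have ab: "?S (\<lambda>i k l. c i k l * c l i k) = 0"
  proof -
    have "?S (\<lambda>i k l. c i k l * c l i k) = ?S (\<lambda>i k l. - (c i k l * c i l k))"
      by (intro sum.cong refl) (metis anti mult_minus_right)
    thus ?thesis using K by (simp add: sum_negf)
  qed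
  have ad: "?S (\<lambda>i k l. c i k l * c l k i) = 0"
  proof -
    have "?S (\<lambda>i k l. c i k l * c l k i) = ?S (\<lambda>i k l. c k i l * c k l i)"
      by (intro sum.cong refl) (metis anti minus_mult_minus)
    thus ?thesis using swap[of "\<lambda>i k l. c i k l * c i l k"] K by simp
  qed
  have H: "?S (\<lambda>i k l. g k k l * g i i l) = 0"
  proof -
    \<comment> \<open>Antisymmetry removes \<open>c k k l\<close>, so summing \<open>g k k l\<close>
      over \<open>k\<close> gives the trace in \<open>uni\<close>.\<close>
    have G: "g k k l = c l k k" if "k \<in> E" "l \<in> E" for k l
      using g[of k k l] anti[of k k l] that by simp
    have "?S (\<lambda>i k l. g k k l * g i i l) = (\<Sum>i\<in>E. \<Sum>l\<in>E. \<Sum>k\<in>E. g k k l * g i i l)"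
      by (rule sum.cong[OF refl]) (rule sum.swap)
    also have "\<dots> = (\<Sum>i\<in>E. \<Sum>l\<in>E. (\<Sum>k\<in>E. c l k k) * g i i l)"
      by (intro sum.cong refl) (simp add: sum_distrib_right G)
    also have "\<dots> = 0" using uni by simp
    finally show ?thesis .
  qed
  \<comment> \<open>In the letters above, the first product is ((b + d)^2 - a^2) / 4 and the last is
    a (d - b + a) / 2. The squares thus have total weight 1/4 + 1/4 - 3/4 = -1/4.\<close>
  have "?S (\<lambda>i k l. g i k l * g k i l - g k k l * g i i l - c i k l * g l k i)
      = ?S (\<lambda>i k l. 1/4 * (c l i k)\<^sup>2 + 1/4 * (c l k i)\<^sup>2 - 3/4 * (c i k l)\<^sup>2
          + 1/2 * (c l i k * c l k i) + 1/2 * (c i k l * c l i k) - 1/2 * (c i k l * c l k i)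
          - g k k l * g i i l)"
  proof (intro sum.cong refl)
    fix i k l assume E: "i \<in> E" "k \<in> E" "l \<in> E"
    have "g i k l = (c i k l + c l i k + c l k i) / 2"
         "g k i l = (- c i k l + c l i k + c l k i) / 2"
         "g l k i = (c l k i - c l i k + c i k l) / 2"
      using E g[of i k l] g[of k i l] g[of l k i] anti[of i k l] anti[of l i k] anti[of l k i]
      by auto
    thus "g i k l * g k i l - g k k l * g i i l - c i k l * g l k i
      = 1/4 * (c l i k)\<^sup>2 + 1/4 * (c l k i)\<^sup>2 - 3/4 * (c i k l)\<^sup>2
          + 1/2 * (c l i k * c l k i) + 1/2 * (c i k l * c l i k) - 1/2 * (c i k l * c l k i)
          - g k k l * g i i l"
      by (simp only:) (simp add: field_simps power2_eq_square)
  qed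
  also have "\<dots> = 1/4 * ?S (\<lambda>i k l. (c l i k)\<^sup>2) + 1/4 * ?S (\<lambda>i k l. (c l k i)\<^sup>2) - 3/4 * ?sq
      + 1/2 * ?S (\<lambda>i k l. c l i k * c l k i) + 1/2 * ?S (\<lambda>i k l. c i k l * c l i k)
      - 1/2 * ?S (\<lambda>i k l. c i k l * c l k i) - ?S (\<lambda>i k l. g k k l * g i i l)"
    by (simp only: sum.distrib sum_subtractf sum_distrib_left)
  also have "\<dots> = - ?sq / 4"
    unfolding b2 d2 bd ab ad H by simp
  finally have "?sq = 0" using scal by simp
  hence "\<forall>i\<in>E. \<forall>j\<in>E. \<forall>k\<in>E. (c i j k)\<^sup>2 = 0"
    using fin by (simp add: sum_nonneg_eq_0_iff sum_nonneg)
  thus ?thesis using ijk by simp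
qed

section \<open>Levi-Civita connection and Ricci tensor\<close>

lemma bilinear_from_add:
  assumes "bilinear_from V h" "x \<in> V" "y \<in> V" "z \<in> V"
  shows "h (x + y) z = h x z + h y z" "h z (x + y) = h z x + h z y"
  using assms by (auto simp: bilinear_from_def linear_from_def)

lemma bilinear_from_scale:
  assumes "bilinear_from V h" "x \<in> V" "y \<in> V"
  shows "h (c *\<^sub>R x) y = c *\<^sub>R h x y" "h x (c *\<^sub>R y) = c *\<^sub>R h x y"
  using assms by (auto simp: bilinear_from_def linear_from_def)

lemma bilinear_from_minus:
  assumes "bilinear_from V h" "x \<in> V" "y \<in> V"
  shows "h (- x) y = - h x y" "h x (- y) = - h x y"
  using bilinear_from_scale[OF assms, of "-1"] by auto

lemma bilinear_from_diff:
  assumes "subspace V" "bilinear_from V h" "x \<in> V" "y \<in> V" "z \<in> V"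
  shows "h (x - y) z = h x z - h y z" "h z (x - y) = h z x - h z y"
  using bilinear_from_add[OF assms(2,3) subspace_neg[OF assms(1,4)] assms(5)]
    bilinear_from_minus[OF assms(2,4,5)] bilinear_from_minus[OF assms(2,5,4)] by auto

lemma bilinear_from_zero:
  assumes "subspace V" "bilinear_from V h" "x \<in> V"
  shows "h 0 x = 0" "h x 0 = 0"
  using bilinear_from_scale[OF assms(2) subspace_0[OF assms(1)] assms(3), of 0]
    bilinear_from_scale[OF assms(2,3) subspace_0[OF assms(1)], of 0] by auto

lemma bilinear_from_sum:
  assumes "subspace V" "bilinear_from V h" "finite I" "\<And>i. i \<in> I \<Longrightarrow> b i \<in> V" "z \<in> V"
  shows "h (\<Sum>i\<in>I. c i *\<^sub>R b i) z = (\<Sum>i\<in>I. c i *\<^sub>R h (b i) z)"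
    and "h z (\<Sum>i\<in>I. c i *\<^sub>R b i) = (\<Sum>i\<in>I. c i *\<^sub>R h z (b i))"
proof -
  have lin: "linear_from V (\<lambda>x. h x z)" "linear_from V (h z)"
    using assms(2,5) by (auto simp: bilinear_from_def)
  show "h (\<Sum>i\<in>I. c i *\<^sub>R b i) z = (\<Sum>i\<in>I. c i *\<^sub>R h (b i) z)"
    using linear_from_sum[OF assms(1) lin(1) assms(3), of b c] assms(4) by simp
  show "h z (\<Sum>i\<in>I. c i *\<^sub>R b i) = (\<Sum>i\<in>I. c i *\<^sub>R h z (b i))"
    using linear_from_sum[OF assms(1) lin(2) assms(3), of b c] assms(4) by simp
qed

context metric_lie_algebra
begin

abbreviation nabla where "nabla \<equiv> levi_civita V br ip"
abbreviation R where "R \<equiv> curvature V br ip"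
abbreviation ric where "ric \<equiv> ricci_tensor V br ip"
abbreviation Ric where "Ric \<equiv> ricci_operator V br ip"

lemma subspace_V: "subspace V"
  using fin_dim by (auto simp: fin_dim_space_def)

lemmas closed =
  subspace_0[OF subspace_V] subspace_add[OF subspace_V] subspace_diff[OF subspace_V]
  subspace_neg[OF subspace_V] subspace_scale[OF subspace_V] br_closed levi_civita_koszul(1)

lemmas ip_linear =
  bilinear_from_add[OF ip_bilinear] bilinear_from_diff[OF subspace_V ip_bilinear]
  bilinear_from_minus[OF ip_bilinear] bilinear_from_scale[OF ip_bilinear]
  bilinear_from_zero[OF subspace_V ip_bilinear]

lemmas br_linear =
  bilinear_from_add[OF br_bilinear] bilinear_from_diff[OF subspace_V br_bilinear]
  bilinear_from_minus[OF br_bilinear] bilinear_from_scale[OF br_bilinear]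
  bilinear_from_zero[OF subspace_V br_bilinear]

lemma br_anti:
  assumes "x \<in> V" "y \<in> V"
  shows "br y x = - br x y"
proof -
  have "0 = br (x + y) (x + y)" using assms br_alternating[of "x + y"] by (simp add: closed)
  also have "\<dots> = br x y + br y x"
    using assms by (simp add: br_linear closed br_alternating[of x] br_alternating[of y])
  finally have "br x y + br y x = 0" by (rule sym)
  thus ?thesis by (metis minus_unique)
qed

lemma ip_eqI:
  assumes "x \<in> V" "y \<in> V" "\<And>z. z \<in> V \<Longrightarrow> ip x z = ip y z"
  shows "x = y"
  using ip_nondegenerate[of "x - y"] assms by (simp add: closed ip_linear)

lemma ip_nabla:
  assumes "x \<in> V" "y \<in> V" "z \<in> V"
  shows "ip (nabla x y) z = (ip (br x y) z + ip (br z x) y + ip x (br z y)) / 2"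
  using levi_civita_koszul(2)[OF assms] by simp

lemma nabla_bilinear: "bilinear_from V nabla"
  unfolding bilinear_from_def linear_from_def
  by (intro conjI ballI allI; rule ip_eqI; simp add: ip_nabla closed ip_linear br_linear field_simps)

lemmas nabla_linear =
  bilinear_from_add[OF nabla_bilinear] bilinear_from_diff[OF subspace_V nabla_bilinear]
  bilinear_from_minus[OF nabla_bilinear] bilinear_from_scale[OF nabla_bilinear]
  bilinear_from_zero[OF subspace_V nabla_bilinear]

text \<open>Metric compatibility: in the sum of the two Koszul expressions the six bracket terms
  cancel in pairs.\<close>

lemma nabla_skew:
  assumes "x \<in> V" "y \<in> V" "z \<in> V"
  shows "ip (nabla x y) z = - ip y (nabla x z)"
proof -
  have "ip (nabla x y) z = - ip (nabla x z) y"
    using assms br_anti[of x y] br_anti[of z x] br_anti[of z y]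
    by (simp add: ip_nabla closed ip_linear field_simps)
  thus ?thesis using assms ip_sym[of y "nabla x z"] by (simp add: closed)
qed

text \<open>Torsion-freeness: the last two Koszul terms together are symmetric in \<open>x\<close>
  and \<open>y\<close>, so only the bracket term survives the difference.\<close>

lemma nabla_torsion:
  assumes "x \<in> V" "y \<in> V"
  shows "nabla x y - nabla y x = br x y"
proof (rule ip_eqI)
  fix z assume z: "z \<in> V"
  have "ip (nabla x y) z - ip (nabla y x) z = ip (br x y) z"
    using assms z br_anti[of x y] ip_sym[of x "br z y"] ip_sym[of y "br z x"]
    by (simp add: ip_nabla closed ip_linear field_simps)
  thus "ip (nabla x y - nabla y x) z = ip (br x y) z"
    using assms z by (simp add: ip_linear closed)
qed (use assms closed in auto)

section \<open>Symmetries of the curvature tensor\<close>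

lemma R_closed: "x \<in> V \<Longrightarrow> y \<in> V \<Longrightarrow> z \<in> V \<Longrightarrow> R x y z \<in> V"
  by (simp add: curvature_def closed)

lemma R_anti:
  assumes "x \<in> V" "y \<in> V" "z \<in> V"
  shows "R y x z = - R x y z"
  using assms br_anti[of x y] by (simp add: curvature_def closed nabla_linear)

lemma R_skew:
  assumes "x \<in> V" "y \<in> V" "z \<in> V" "w \<in> V"
  shows "ip (R x y z) w = - ip (R x y w) z"
proof -
  have e: "ip (R a b c) d = ip (nabla a (nabla b c)) d - ip (nabla b (nabla a c)) d - ip (nabla (br a b) c) d"
    if "a \<in> V" "b \<in> V" "c \<in> V" "d \<in> V" for a b c d
    using that by (simp add: curvature_def closed ip_linear)
  \<comment> \<open>Carrying both derivatives across the form costs two signs and reverses their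
    order, which exchanges the two second-order terms of the curvature.\<close>
  have s: "ip (nabla a (nabla b c)) d = ip (nabla b (nabla a d)) c"
    if "a \<in> V" "b \<in> V" "c \<in> V" "d \<in> V" for a b c d
    using that by (simp add: nabla_skew[of a "nabla b c" d] nabla_skew[of b c "nabla a d"]
      ip_sym[of c "nabla b (nabla a d)"] closed)
  have t: "ip (nabla (br x y) z) w = - ip (nabla (br x y) w) z"
    using assms by (simp add: nabla_skew[of "br x y" z w] ip_sym[of z "nabla (br x y) w"] closed)
  show ?thesis
    using e[of x y z w] e[of x y w z] s[of x y z w] s[of y x z w] t assms by simp
qed

text \<open>First Bianchi identity: grouped by outer derivative, the terms become double brackets
  after two uses of torsion-freeness, and these sum to zero by Jacobi.\<close>

lemma R_bianchi:
  assumes V: "x \<in> V" "y \<in> V" "z \<in> V"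
  shows "R x y z + R y z x + R z x y = 0"
proof -
  have *: "nabla a (nabla b c) - nabla a (nabla c b) - nabla (br b c) a = br a (br b c)"
    if "a \<in> V" "b \<in> V" "c \<in> V" for a b c
    using that nabla_torsion[of a "br b c"] nabla_torsion[of b c, symmetric]
    by (simp add: closed nabla_linear)
  have "R x y z + R y z x + R z x y =
      (nabla x (nabla y z) - nabla x (nabla z y) - nabla (br y z) x)
      + (nabla y (nabla z x) - nabla y (nabla x z) - nabla (br z x) y)
      + (nabla z (nabla x y) - nabla z (nabla y x) - nabla (br x y) z)"
    by (simp add: curvature_def)
  thus ?thesis using V by (simp only: * jacobi)
qed

text \<open>The octahedron argument: four Bianchi identities, one for each vector kept in the last
  slot, are combined with the two antisymmetries.\<close>

lemma R_pair:
  assumes V: "x \<in> V" "y \<in> V" "z \<in> V" "w \<in> V"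
  shows "ip (R x y z) w = ip (R z w x) y"
proof -
  have b: "ip (R a b c) d + ip (R b c a) d + ip (R c a b) d = 0"
    if "a \<in> V" "b \<in> V" "c \<in> V" "d \<in> V" for a b c d
    using R_bianchi[of a b c] that ip_linear(1)[of "R a b c + R b c a" "R c a b" d]
      ip_linear(1)[of "R a b c" "R b c a" d] ip_linear(9)[of d]
    by (simp add: closed R_closed)
  have a: "ip (R a b c) d = - ip (R b a c) d"
    if "a \<in> V" "b \<in> V" "c \<in> V" "d \<in> V" for a b c d
    using R_anti[of a b c] that by (simp add: ip_linear R_closed)
  show ?thesis
    using b[of y z x w] b[of z x w y] b[of x w y z] b[of w y z x]
      R_skew[of y z x w] R_skew[of z x y w] R_skew[of x w y z] R_skew[of w y z x]
      a[of y x w z] R_skew[of x y w z] a[of z w y x] R_skew[of w z y x] a[of z w x y] V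
    by simp
qed

section \<open>Traces through dual bases and the Ricci tensor\<close>

lemma representation_dual:
  assumes B: "basis_of V B" and d: "\<And>b. b \<in> B \<Longrightarrow> d b \<in> V"
    and dual: "\<And>a b. a \<in> B \<Longrightarrow> b \<in> B \<Longrightarrow> ip a (d b) = (if a = b then 1 else 0)"
    and x: "x \<in> V" and b: "b \<in> B"
  shows "representation B x b = ip x (d b)"
proof -
  have fin: "finite B" using basis_of_finite[OF fin_dim B] .
  have BV: "b \<in> V" if "b \<in> B" for b
    using that B span_base[of b B] by (simp add: basis_of_def)
  have "ip x (d b) = ip (\<Sum>a\<in>B. representation B x a *\<^sub>R a) (d b)"
    using sum_representation_eq[of B x B] B fin x by (simp add: basis_of_def)
  also have "\<dots> = (\<Sum>a\<in>B. representation B x a *\<^sub>R ip a (d b))"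
    by (rule bilinear_from_sum[OF subspace_V ip_bilinear fin BV d[OF b]])
  also have "\<dots> = (\<Sum>a\<in>B. if a = b then representation B x a else 0)"
    by (rule sum.cong) (auto simp: dual b)
  finally show ?thesis using fin b by simp
qed

text \<open>Leaving the dual family \<open>d\<close> free covers both uses: sign-corrected
  orthonormal bases, and null frames in which \<open>u\<close> and \<open>v\<close> are dual to each
  other.\<close>

lemma trace_dual:
  assumes B: "basis_of V B" and d: "\<And>b. b \<in> B \<Longrightarrow> d b \<in> V"
    and dual: "\<And>a b. a \<in> B \<Longrightarrow> b \<in> B \<Longrightarrow> ip a (d b) = (if a = b then 1 else 0)"
    and f: "endo V f"
  shows "trace_on V f = (\<Sum>b\<in>B. ip (f b) (d b))"
proof -
  have "b \<in> V" if "b \<in> B" for b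
    using that B span_base[of b B] by (simp add: basis_of_def)
  thus ?thesis
    unfolding trace_on_basis[OF fin_dim f B]
    using f by (intro sum.cong refl representation_dual[OF B d dual]) (auto simp: endo_def)
qed

lemma R_endo:
  assumes "x \<in> V" "y \<in> V"
  shows "endo V (\<lambda>\<xi>. R \<xi> x y)"
  using assms by (auto simp: endo_def linear_from_def curvature_def closed nabla_linear br_linear
    algebra_simps)

lemma signature_basis:
  assumes "has_signature V ip p q"
  obtains B where "basis_of V B" "finite B" "B \<subseteq> V"
    "\<And>a b. a \<in> B \<Longrightarrow> b \<in> B \<Longrightarrow> ip a (ip b b *\<^sub>R b) = (if a = b then 1 else 0)"
proof -
  obtain N P where NP: "basis_of V (N \<union> P)" "\<forall>x\<in>N. ip x x = -1" "\<forall>x\<in>P. ip x x = 1"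
    "\<forall>x\<in>N \<union> P. \<forall>y\<in>N \<union> P. x \<noteq> y \<longrightarrow> ip x y = 0"
    using assms by (auto simp: has_signature_def)
  have sub: "N \<union> P \<subseteq> V" using NP(1) span_superset[of "N \<union> P"] by (simp add: basis_of_def)
  have "ip a (ip b b *\<^sub>R b) = (if a = b then 1 else 0)" if ab: "a \<in> N \<union> P" "b \<in> N \<union> P" for a b
  proof -
    have "a \<in> V" "b \<in> V" using ab sub by blast+
    hence "ip a (ip b b *\<^sub>R b) = ip b b * ip a b" by (simp add: ip_linear)
    also have "\<dots> = (if a = b then 1 else 0)"
      using ab NP(2-4) by auto
    finally show ?thesis .
  qed
  thus thesis using that[OF NP(1) basis_of_finite[OF fin_dim NP(1)] sub] by blast
qed

lemma ric_dual:
  assumes B: "basis_of V B" and d: "\<And>b. b \<in> B \<Longrightarrow> d b \<in> V"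
    and dual: "\<And>a b. a \<in> B \<Longrightarrow> b \<in> B \<Longrightarrow> ip a (d b) = (if a = b then 1 else 0)"
    and V: "x \<in> V" "y \<in> V"
  shows "ric x y = (\<Sum>b\<in>B. ip (R b x y) (d b))"
  unfolding ricci_tensor_def by (rule trace_dual[OF B d dual R_endo[OF V]])

text \<open>In a signed orthonormal basis each dual vector is a multiple of \<open>b\<close> itself,
  so pair symmetry followed by the two antisymmetries makes every summand symmetric in
  \<open>x\<close> and \<open>y\<close>.\<close>

lemma ric_sym:
  assumes sig: "has_signature V ip p q" and V: "x \<in> V" "y \<in> V"
  shows "ric x y = ric y x"
proof -
  obtain B where B: "basis_of V B" "B \<subseteq> V"
    "\<And>a b. a \<in> B \<Longrightarrow> b \<in> B \<Longrightarrow> ip a (ip b b *\<^sub>R b) = (if a = b then 1 else 0)"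
    using signature_basis[OF sig] by metis
  have BV: "b \<in> V" if "b \<in> B" for b using that B(2) by blast
  have d: "ip b b *\<^sub>R b \<in> V" if "b \<in> B" for b using BV[OF that] by (simp add: closed)
  have "ip (R b x y) (ip b b *\<^sub>R b) = ip (R b y x) (ip b b *\<^sub>R b)" if b: "b \<in> B" for b
  proof -
    have "ip (R b x y) b = ip (R y b b) x" by (rule R_pair[OF BV[OF b] V BV[OF b]])
    also have "\<dots> = - ip (R y b x) b" by (rule R_skew[OF V(2) BV[OF b] BV[OF b] V(1)])
    also have "\<dots> = ip (R b y x) b"
      using R_anti[OF BV[OF b] V(2,1)] BV[OF b] V by (simp add: ip_linear R_closed)
    finally show ?thesis using BV[OF b] V by (simp add: ip_linear R_closed)
  qed
  thus ?thesis
    using ric_dual[of B "\<lambda>b. ip b b *\<^sub>R b", OF B(1) d B(3)] V by simp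
qed

lemma ric_linear:
  assumes x: "x \<in> V"
  shows "linear_from V (ric x)"
proof -
  obtain B where B: "basis_of V B" using fin_dim fin_dim_space_basis by blast
  have BV: "b \<in> V" if "b \<in> B" for b
    using that B span_base[of b B] by (simp add: basis_of_def)
  have ind: "independent B" "span B = V" using B by (auto simp: basis_of_def)
  have add: "R b x (y + z) = R b x y + R b x z" if "b \<in> B" "y \<in> V" "z \<in> V" for b y z
    using that BV x by (simp add: curvature_def closed nabla_linear algebra_simps)
  have scale: "R b x (c *\<^sub>R y) = c *\<^sub>R R b x y" if "b \<in> B" "y \<in> V" for b y c
    using that BV x by (simp add: curvature_def closed nabla_linear algebra_simps)
  have ric: "ric x y = (\<Sum>b\<in>B. representation B (R b x y) b)" if "y \<in> V" for y
    unfolding ricci_tensor_def by (rule trace_on_basis[OF fin_dim R_endo[OF x that] B])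
  show ?thesis
    unfolding linear_from_def
    using BV x by (simp add: ric closed add scale ind representation_add representation_scale R_closed
      sum.distrib sum_distrib_left)
qed

lemma
  assumes "x \<in> V"
  shows Ric_closed: "Ric x \<in> V" and ip_Ric: "\<And>y. y \<in> V \<Longrightarrow> ip (Ric x) y = ric x y"
  using theI'[OF riesz[OF ric_linear[OF assms]]] unfolding ricci_operator_def by blast+

end

section \<open>Null frames of Lorentz forms\<close>

context metric_lie_algebra
begin

text \<open>On the complement of the negative basis vector \<open>t\<close> the form is the sum of
  the squares of the \<open>P\<close>-coordinates; a nonzero vector with all of these zero would
  contradict nondegeneracy.\<close>

lemma lorentz_timelike:
  assumes "lorentz_form V ip"
  obtains t where "t \<in> V" "ip t t = -1"
    "\<And>x. x \<in> V \<Longrightarrow> ip x t = 0 \<Longrightarrow> x \<noteq> 0 \<Longrightarrow> ip x x > 0"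
proof -
  obtain N P where NP: "N \<inter> P = {}" "basis_of V (N \<union> P)" "card N = 1" "\<forall>x\<in>N. ip x x = -1"
    "\<forall>x\<in>P. ip x x = 1" "\<forall>x\<in>N \<union> P. \<forall>y\<in>N \<union> P. x \<noteq> y \<longrightarrow> ip x y = 0"
    using assms by (auto simp: lorentz_form_def has_signature_def)
  obtain t where N: "N = {t}" using NP(3) card_1_singletonE by blast
  let ?B = "insert t P"
  have B: "basis_of V ?B" and tP: "t \<notin> P" using NP(1,2) N by auto
  have fin: "finite ?B" using basis_of_finite[OF fin_dim B] .
  have BV: "b \<in> V" if "b \<in> ?B" for b
    using that B span_base[of b ?B] by (simp add: basis_of_def)
  have dV: "ip b b *\<^sub>R b \<in> V" if "b \<in> ?B" for b using BV[OF that] by (simp add: closed)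
  have dual: "ip a (ip b b *\<^sub>R b) = (if a = b then 1 else 0)" if ab: "a \<in> ?B" "b \<in> ?B" for a b
  proof -
    have "ip a (ip b b *\<^sub>R b) = ip b b * ip a b" using BV ab by (simp add: ip_linear)
    also have "\<dots> = (if a = b then 1 else 0)" using ab NP(4-6) N by auto
    finally show ?thesis .
  qed
  have ip_B: "ip x y = ip t t * ip x t * ip t y + (\<Sum>p\<in>P. ip x p * ip p y)"
    if xy: "x \<in> V" "y \<in> V" for x y
  proof -
    have "x = (\<Sum>b\<in>?B. representation ?B x b *\<^sub>R b)"
      using sum_representation_eq[of ?B x ?B] B fin xy by (simp add: basis_of_def)
    also have "\<dots> = (\<Sum>b\<in>?B. (ip b b * ip x b) *\<^sub>R b)"
    proof (rule sum.cong[OF refl])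
      fix b assume b: "b \<in> ?B"
      have "representation ?B x b = ip x (ip b b *\<^sub>R b)"
        by (rule representation_dual[OF B dV dual xy(1) b])
      thus "representation ?B x b *\<^sub>R b = (ip b b * ip x b) *\<^sub>R b"
        using BV[OF b] xy by (simp add: ip_linear)
    qed
    finally have "ip x y = ip (\<Sum>b\<in>?B. (ip b b * ip x b) *\<^sub>R b) y" by (rule arg_cong)
    also have "\<dots> = (\<Sum>b\<in>?B. (ip b b * ip x b) *\<^sub>R ip b y)"
      by (rule bilinear_from_sum(1)[OF subspace_V ip_bilinear fin BV xy(2)])
    finally show ?thesis using fin tP NP(5) by simp
  qed
  have "ip x x > 0" if x: "x \<in> V" "ip x t = 0" "x \<noteq> 0" for x
  proof -
    have "ip x x = (\<Sum>p\<in>P. (ip x p)\<^sup>2)"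
      using ip_B[OF x(1,1)] x(2) ip_sym[OF x(1) BV] by (simp add: power2_eq_square cong: sum.cong)
    moreover have "(\<Sum>p\<in>P. (ip x p)\<^sup>2) \<noteq> 0"
    proof
      assume "(\<Sum>p\<in>P. (ip x p)\<^sup>2) = 0"
      hence "\<forall>p\<in>P. ip x p = 0" using fin by (simp add: sum_nonneg_eq_0_iff)
      hence "\<forall>y\<in>V. ip x y = 0" using ip_B[OF x(1)] x(2) by simp
      thus False using ip_nondegenerate x by blast
    qed
    moreover have "(\<Sum>p\<in>P. (ip x p)\<^sup>2) \<ge> 0" by (simp add: sum_nonneg)
    ultimately show ?thesis by linarith
  qed
  thus thesis using that[of t] BV[of t] NP(4) N by auto
qed

text \<open>Positivity is stated on \<open>span B\<close>, because the form is indefinite on the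
  ambient space where this is applied.\<close>

lemma gram_schmidt:
  assumes "finite B" "span B \<subseteq> V" "\<And>x. x \<in> span B \<Longrightarrow> x \<noteq> 0 \<Longrightarrow> ip x x > 0"
  shows "\<exists>E. finite E \<and> span E = span B \<and>
    (\<forall>e\<in>E. \<forall>e'\<in>E. ip e e' = (if e = e' then 1 else 0))"
  using assms
proof (induction B rule: finite_induct)
  case empty
  show ?case by (rule exI[of _ "{}"]) simp
next
  case (insert b B)
  have mono: "span B \<subseteq> span (insert b B)" by (rule span_mono) blast
  have "\<And>x. x \<in> span B \<Longrightarrow> x \<noteq> 0 \<Longrightarrow> ip x x > 0"
    using mono insert.prems(2) by blast
  from insert.IH[OF order.trans[OF mono insert.prems(1)] this] obtain E where E: "finite E" "span E = span B"
    "\<forall>e\<in>E. \<forall>e'\<in>E. ip e e' = (if e = e' then 1 else 0)"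
    by blast
  have b: "b \<in> span (insert b B)" "b \<in> V" using insert.prems(1) span_base by blast+
  have EV: "e \<in> V" if "e \<in> E" for e
    using that span_base[of e E] E(2) mono insert.prems(1) by blast
  define p where "p = (\<Sum>e\<in>E. ip b e *\<^sub>R e)"
  have pE: "p \<in> span E" unfolding p_def by (intro span_sum span_scale span_base)
  hence pV: "p \<in> V" "p \<in> span (insert b B)" using E(2) mono insert.prems(1) by blast+
  have perp: "ip (b - p) e = 0" if e: "e \<in> E" for e
  proof -
    have "ip p e = (\<Sum>a\<in>E. ip b a *\<^sub>R ip a e)"
      unfolding p_def by (rule bilinear_from_sum(1)[OF subspace_V ip_bilinear E(1) EV EV[OF e]])
    also have "\<dots> = (\<Sum>a\<in>E. if a = e then ip b a else 0)"
      using E(3) e by (intro sum.cong) auto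
    finally show ?thesis using e E(1) b(2) pV EV[OF e] by (simp add: ip_linear)
  qed
  show ?case
  \<comment> \<open>If \<open>b\<close> equals its projection it is redundant and \<open>E\<close>
    is kept; thus \<open>B\<close> may be dependent.\<close>
  proof (cases "b = p")
    case True
    have "span (insert b B) = span B"
      using pE E(2) True by (intro span_redundant) simp
    thus ?thesis using E by metis
  next
    case False
    define r where "r = sqrt (ip (b - p) (b - p))"
    have bp: "b - p \<in> span (insert b B)" "b - p \<in> V"
      using b pV by (simp_all add: span_diff closed)
    have pos: "ip (b - p) (b - p) > 0" using insert.prems(2) bp False by simp
    hence r: "r > 0" "r * r = ip (b - p) (b - p)" by (auto simp: r_def)
    define y where "y = (1 / r) *\<^sub>R (b - p)"
    have yV: "y \<in> V" using bp by (simp add: y_def closed)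
    have ye: "ip y e = 0" "ip e y = 0" if "e \<in> E" for e
      using perp[OF that] EV[OF that] bp ip_sym[OF yV EV[OF that]] by (simp_all add: y_def ip_linear)
    have yy: "ip y y = 1"
      using bp r by (simp add: y_def ip_linear closed flip: r(2))
    have yE: "y \<notin> E" using ye yy by force
    have "span (insert y E) = span (insert b B)"
      unfolding span_eq
    proof
      have "y \<in> span (insert b B)" unfolding y_def by (rule span_scale[OF bp(1)])
      thus "insert y E \<subseteq> span (insert b B)" using E(2) mono span_superset[of E] by blast
      have "b = r *\<^sub>R y + p" using r by (simp add: y_def)
      moreover have "p \<in> span (insert y E)" using pE span_mono[of E "insert y E"] by blast
      ultimately have "b \<in> span (insert y E)" by (simp add: span_add span_scale span_base)
      moreover have "B \<subseteq> span (insert y E)"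
        using E(2) span_mono[of E "insert y E"] span_superset[of B] by blast
      ultimately show "insert b B \<subseteq> span (insert y E)" by blast
    qed
    thus ?thesis using E(1,3) ye yy yE by (intro exI[of _ "insert y E"]) auto
  qed
qed

lemma fin_dim_subspace:
  assumes W: "subspace W" "W \<subseteq> V"
  obtains B where "finite B" "span B = W"
proof -
  obtain S where S: "finite S" "V = span S" using fin_dim by (auto simp: fin_dim_space_def)
  obtain B where B: "B \<subseteq> W" "independent B" "W \<subseteq> span B"
    by (rule maximal_independent_subset)
  have "finite B" using independent_span_bound[OF S(1) B(2)] B(1) W(2) S(2) by blast
  moreover have "span B = W" using B span_minimal[OF B(1) W(1)] by blast
  ultimately show thesis by (rule that)
qed

end

text \<open>\<open>u\<close> and \<open>v\<close> span a hyperbolic plane and \<open>E\<close> is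
  orthonormal in its complement. Completeness is encoded by \<open>expansion\<close>: pairing with
  \<open>v\<close> reads off the \<open>u\<close>-coordinate and vice versa.\<close>

locale null_frame = metric_lie_algebra V br ip
  for V :: "'a::real_vector set" and br :: "'a \<Rightarrow> 'a \<Rightarrow> 'a" and ip :: "'a \<Rightarrow> 'a \<Rightarrow> real" +
  fixes u v :: 'a and E :: "'a set"
  assumes frame_in: "u \<in> V" "v \<in> V" "E \<subseteq> V"
    and finite_E: "finite E"
    and u_null: "ip u u = 0" and v_null: "ip v v = 0" and uv: "ip u v = 1"
    and uE: "\<And>e. e \<in> E \<Longrightarrow> ip u e = 0" and vE: "\<And>e. e \<in> E \<Longrightarrow> ip v e = 0"
    and EE: "\<And>e e'. e \<in> E \<Longrightarrow> e' \<in> E \<Longrightarrow> ip e e' = (if e = e' then 1 else 0)"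
    and expansion: "\<And>x. x \<in> V \<Longrightarrow> x = ip x v *\<^sub>R u + ip x u *\<^sub>R v + (\<Sum>e\<in>E. ip x e *\<^sub>R e)"
begin

lemma E_in: "e \<in> E \<Longrightarrow> e \<in> V" using frame_in by blast

lemma vu: "ip v u = 1" using uv ip_sym frame_in by simp

lemma Eu: "e \<in> E \<Longrightarrow> ip e u = 0" and Ev: "e \<in> E \<Longrightarrow> ip e v = 0"
  using uE vE ip_sym frame_in E_in by metis+

lemma frame_notin: "u \<notin> E" "v \<notin> E" "u \<noteq> v"
  using uE[of v] vE[of u] uv vu u_null by auto

lemma ip_expansion:
  assumes "x \<in> V" "y \<in> V"
  shows "ip x y = ip x v * ip y u + ip x u * ip y v + (\<Sum>e\<in>E. ip x e * ip y e)"
proof -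
  have sE: "(\<Sum>e\<in>E. ip x e *\<^sub>R e) \<in> V"
    using E_in by (intro subspace_sum[OF subspace_V]) (simp add: closed)
  have "ip x y = ip (ip x v *\<^sub>R u + ip x u *\<^sub>R v + (\<Sum>e\<in>E. ip x e *\<^sub>R e)) y"
    using expansion[OF assms(1)] by simp
  also have "\<dots> = ip x v * ip u y + ip x u * ip v y + ip (\<Sum>e\<in>E. ip x e *\<^sub>R e) y"
    using assms frame_in sE by (simp add: closed ip_linear)
  also have "ip (\<Sum>e\<in>E. ip x e *\<^sub>R e) y = (\<Sum>e\<in>E. ip x e * ip e y)"
    using bilinear_from_sum(1)[OF subspace_V ip_bilinear finite_E E_in assms(2), where c = "ip x"] by simp
  finally show ?thesis
    using ip_sym[OF frame_in(1) assms(2)] ip_sym[OF frame_in(2) assms(2)]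
      ip_sym[OF E_in assms(2)] by (simp cong: sum.cong)
qed

text \<open>On the complement of \<open>v\<close> the form is the sum of the squares of the
  \<open>E\<close>-coordinates, so its null vectors have no \<open>E\<close>-component.\<close>

lemma null_perp:
  assumes "x \<in> V" "ip x v = 0" "ip x x = 0"
  shows "x = ip x u *\<^sub>R v"
proof -
  have "(\<Sum>e\<in>E. (ip x e)\<^sup>2) = 0"
    using ip_expansion[OF assms(1,1)] assms by (simp add: power2_eq_square)
  hence "\<forall>e\<in>E. ip x e = 0" using finite_E by (simp add: sum_nonneg_eq_0_iff)
  thus ?thesis using expansion[OF assms(1)] assms(2) by simp
qed

lemma frame_basis: "basis_of V (insert u (insert v E))"
proof -
  let ?B = "insert u (insert v E)"
  have "independent ?B"
  proof (rule independent_if_scalars_zero)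
    show "finite ?B" using finite_E by simp
    fix f b assume f: "(\<Sum>x\<in>?B. f x *\<^sub>R x) = 0" and b: "b \<in> ?B"
    let ?s = "\<Sum>e\<in>E. f e *\<^sub>R e"
    have sE: "?s \<in> V" using E_in by (intro subspace_sum[OF subspace_V]) (simp add: closed)
    have 0: "f u *\<^sub>R u + (f v *\<^sub>R v + ?s) = 0"
      using f frame_notin finite_E by simp
    have ips: "ip ?s y = (\<Sum>e\<in>E. f e * ip e y)" if "y \<in> V" for y
      using bilinear_from_sum(1)[OF subspace_V ip_bilinear finite_E E_in that, where c = f] by simp
    have z: "f u * ip u y + (f v * ip v y + (\<Sum>e\<in>E. f e * ip e y)) = 0" if y: "y \<in> V" for y
    proof -
      have "ip (f u *\<^sub>R u + (f v *\<^sub>R v + ?s)) y = 0" using y by (simp only: 0) (simp add: ip_linear)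
      thus ?thesis using y frame_in sE ips[OF y] by (simp add: closed ip_linear)
    qed
    show "f b = 0"
    proof (cases "b \<in> E")
      case True
      have "(\<Sum>e\<in>E. f e * ip e b) = (\<Sum>e\<in>E. if e = b then f e else 0)"
        using True by (intro sum.cong) (auto simp: EE)
      thus ?thesis using z[OF E_in[OF True]] True finite_E by (simp add: uE vE)
    next
      case False
      thus ?thesis using b z[of u] z[of v] frame_in by (auto simp: u_null v_null uv vu Eu Ev)
    qed
  qed
  moreover have "x \<in> span ?B" if "x \<in> V" for x
    by (subst expansion[OF that]) (intro span_add span_scale span_sum span_base; simp)
  moreover have "span ?B \<subseteq> V" using frame_in by (intro span_minimal subspace_V) auto
  ultimately show ?thesis by (auto simp: basis_of_def)
qed

lemma trace_frame:
  assumes f: "endo V f"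
  shows "trace_on V f = ip (f u) v + ip (f v) u + (\<Sum>e\<in>E. ip (f e) e)"
proof -
  \<comment> \<open>The dual frame exchanges \<open>u\<close> and \<open>v\<close> and fixes
    \<open>E\<close>.\<close>
  define d where "d b = (if b = u then v else if b = v then u else b)" for b
  have "trace_on V f = (\<Sum>b\<in>insert u (insert v E). ip (f b) (d b))"
    by (rule trace_dual[OF frame_basis _ _ f])
      (use frame_in frame_notin in \<open>auto simp: d_def u_null v_null uv vu uE vE Eu Ev EE\<close>)
  also have "\<dots> = ip (f u) v + (ip (f v) u + (\<Sum>e\<in>E. ip (f e) (d e)))"
    using frame_notin finite_E by (simp add: d_def)
  also have "(\<Sum>e\<in>E. ip (f e) (d e)) = (\<Sum>e\<in>E. ip (f e) e)"
    using frame_notin by (intro sum.cong) (auto simp: d_def)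
  finally show ?thesis by simp
qed

end

lemma (in metric_lie_algebra) null_frame_exists:
  assumes lor: "lorentz_form V ip" and v: "v \<in> V" "v \<noteq> 0" "ip v v = 0"
  obtains u E where "null_frame V br ip u v E"
proof -
  obtain t where t: "t \<in> V" "ip t t = -1"
    "\<And>x. x \<in> V \<Longrightarrow> ip x t = 0 \<Longrightarrow> x \<noteq> 0 \<Longrightarrow> ip x x > 0"
    using lorentz_timelike[OF lor] by blast
  define a where "a = ip v t"
  \<comment> \<open>A nonzero null vector cannot be orthogonal to \<open>t\<close>, on whose
    complement the form is positive.\<close>
  have a: "a \<noteq> 0" "ip t v = a" using t(3)[OF v(1)] v ip_sym[OF v(1) t(1)] by (auto simp: a_def)
  \<comment> \<open>The first coefficient normalizes the pairing with \<open>v\<close> to 1; the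
    second cancels the square -1 / (a * a) of the timelike part.\<close>
  define u where "u = (1 / a) *\<^sub>R t + (1 / (2 * a * a)) *\<^sub>R v"
  have u: "u \<in> V" using t(1) v(1) by (simp add: u_def closed)
  have ipu: "ip x u = ip x t / a + ip x v / (2 * a * a)" if "x \<in> V" for x
    using that t(1) v(1) by (simp add: u_def closed ip_linear)
  have uv: "ip v u = 1" "ip u v = 1"
    using ipu[OF v(1)] a v(3) ip_sym[OF u v(1)] by (simp_all add: a_def[symmetric])
  have tu: "ip u t = -1 / a + 1 / (2 * a)"
    using t(1,2) v(1) a by (simp add: u_def closed ip_linear a_def[symmetric])
  have uu: "ip u u = 0" using ipu[OF u] uv tu a by (simp add: field_simps)
  define W where "W = {x \<in> V. ip x u = 0 \<and> ip x v = 0}"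
  have W: "subspace W" "W \<subseteq> V"
    using u v(1) by (auto simp: W_def subspace_def closed ip_linear)
  obtain B where B: "finite B" "span B = W" using fin_dim_subspace[OF W] .
  \<comment> \<open>Vectors orthogonal to both \<open>u\<close> and \<open>v\<close> are orthogonal
    to \<open>t\<close>, so \<open>W\<close> inherits positivity.\<close>
  have pos: "ip x x > 0" if "x \<in> W" "x \<noteq> 0" for x
    using that ipu[of x] a t(3)[of x] by (simp add: W_def)
  obtain E where E: "finite E" "span E = W"
    "\<And>e e'. e \<in> E \<Longrightarrow> e' \<in> E \<Longrightarrow> ip e e' = (if e = e' then 1 else 0)"
    using gram_schmidt[OF B(1)] B(2) W(2) pos by metis
  have EW: "e \<in> W" if "e \<in> E" for e using that E(2) span_base by blast
  have EV: "e \<in> V" if "e \<in> E" for e using EW[OF that] W(2) by blast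
  have expW: "x = (\<Sum>e\<in>E. ip x e *\<^sub>R e)" if x: "x \<in> W" for x
  proof -
    obtain f where f: "x = (\<Sum>e\<in>E. f e *\<^sub>R e)"
      using x E(2) span_finite[OF E(1)] by auto
    have "ip x e = f e" if e: "e \<in> E" for e
    proof -
      have "ip x e = (\<Sum>a\<in>E. f a *\<^sub>R ip a e)"
        unfolding f by (rule bilinear_from_sum(1)[OF subspace_V ip_bilinear E(1) EV EV[OF e]])
      also have "\<dots> = (\<Sum>a\<in>E. if a = e then f a else 0)"
        using E(3) e by (intro sum.cong) auto
      finally show ?thesis using e E(1) by simp
    qed
    thus ?thesis using f by simp
  qed
  have "null_frame V br ip u v E"
  proof
    show "u \<in> V" "v \<in> V" "E \<subseteq> V" "finite E" "ip u u = 0" "ip v v = 0" "ip u v = 1"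
      using u v EV E(1) uu uv by auto
    show "ip u e = 0" "ip v e = 0" if "e \<in> E" for e
      using EW[OF that] ip_sym[OF u EV[OF that]] ip_sym[OF v(1) EV[OF that]] by (auto simp: W_def)
    show "ip e e' = (if e = e' then 1 else 0)" if "e \<in> E" "e' \<in> E" for e e'
      by (rule E(3)[OF that])
    fix x assume x: "x \<in> V"
    let ?y = "x - ip x v *\<^sub>R u - ip x u *\<^sub>R v"
    have "?y \<in> W" using x u v by (simp add: W_def closed ip_linear uu uv)
    hence "?y = (\<Sum>e\<in>E. ip ?y e *\<^sub>R e)" by (rule expW)
    also have "\<dots> = (\<Sum>e\<in>E. ip x e *\<^sub>R e)"
    proof (rule sum.cong[OF refl])
      fix e assume e: "e \<in> E"
      have "ip u e = 0" "ip v e = 0"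
        using EW[OF e] ip_sym[OF u EV[OF e]] ip_sym[OF v(1) EV[OF e]] by (auto simp: W_def)
      thus "ip ?y e *\<^sub>R e = ip x e *\<^sub>R e" using x u v EV[OF e] by (simp add: closed ip_linear)
    qed
    finally show "x = ip x v *\<^sub>R u + ip x u *\<^sub>R v + (\<Sum>e\<in>E. ip x e *\<^sub>R e)"
      by (simp add: algebra_simps)
  qed
  thus thesis by (rule that)
qed

section \<open>Parallel null vectors\<close>

text \<open>In the application \<open>v\<close> spans the image of the Ricci operator;
  \<open>parallel\<close> is what Ricci-parallelism yields, and \<open>ric_E\<close> holds because
  \<open>E\<close> is orthogonal to \<open>v\<close>.\<close>

locale parallel_null_frame = null_frame +
  assumes nilpotent: "nilpotent_lie V br"
    and parallel: "\<And>x. x \<in> V \<Longrightarrow> nabla x v = 0"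
    and ric_E: "\<And>e. e \<in> E \<Longrightarrow> ric e e = 0"
begin

section \<open>Centrality of the parallel null vector\<close>

lemma nabla_perp: "x \<in> V \<Longrightarrow> y \<in> V \<Longrightarrow> ip (nabla x y) v = 0"
  using nabla_skew[of x y v] parallel frame_in by (simp add: ip_linear)

lemma br_perp:
  assumes "x \<in> V" "y \<in> V"
  shows "ip (br x y) v = 0"
  using assms nabla_torsion[OF assms, symmetric] nabla_perp frame_in by (simp add: closed ip_linear)

text \<open>In the Koszul formula for \<open>nabla x v = 0\<close> the pairing of
  \<open>br y x\<close> with \<open>v\<close> drops out by \<open>br_perp\<close>, leaving the part
  symmetric in \<open>x\<close> and \<open>y\<close>.\<close>

lemma ad_v_skew:
  assumes "x \<in> V" "y \<in> V"
  shows "ip (br v x) y = - ip x (br v y)"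
proof -
  have "ip (nabla x v) y = 0" using parallel assms by (simp add: ip_linear)
  moreover have "br x v = - br v x" "br y v = - br v y"
    using br_anti assms frame_in by blast+
  ultimately show ?thesis
    using assms frame_in br_perp[of y x] by (simp add: ip_nabla closed ip_linear)
qed

text \<open>The iterate \<open>(br x ^^ j) y\<close> stays in the \<open>j\<close>-th term of the
  lower central series, whose length is therefore an exponent uniform in \<open>x\<close> and
  \<open>y\<close>.\<close>

lemma ad_nilpotent:
  obtains k where "\<And>x y. x \<in> V \<Longrightarrow> y \<in> V \<Longrightarrow> (br x ^^ k) y = 0"
proof -
  obtain k where k: "lower_central V br k = {0}" using nilpotent by (auto simp: nilpotent_lie_def)
  have "(br x ^^ j) y \<in> lower_central V br j" if "x \<in> V" "y \<in> V" for x y j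
    using that by (induction j) (auto intro!: span_base)
  hence "(br x ^^ k) y = 0" if "x \<in> V" "y \<in> V" for x y using k that by blast
  thus thesis by (rule that)
qed

lemma ad_endo: "x \<in> V \<Longrightarrow> endo V (br x)"
  by (auto simp: endo_def linear_from_def closed br_linear)

text \<open>If \<open>(ad v)\<^sup>2 y\<close> is a multiple of \<open>v\<close>, then skewness makes \<open>ad v y\<close> null; this lowers the nilpotency
  degree step by step.\<close>

lemma ad_v_perp:
  assumes "y \<in> V" "ip y v = 0"
  shows "br v y = ip (br v y) u *\<^sub>R v"
proof -
  have v: "v \<in> V" by (rule frame_in)
  \<comment> \<open>The induction tolerates a multiple of \<open>v\<close> in place of zero, because
    \<open>null_perp\<close> returns only such multiples.\<close>
  have step: "\<exists>c. br v y = c *\<^sub>R v"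
    if "y \<in> V" "ip y v = 0" "(br v ^^ Suc m) y = c *\<^sub>R v" for m y c
    using that
  proof (induction m arbitrary: y)
    case 0
    thus ?case by auto
  next
    case (Suc m)
    have vy: "br v y \<in> V" "ip (br v y) v = 0" using Suc.prems v br_perp by (auto simp: closed)
    have "(br v ^^ Suc m) (br v y) = c *\<^sub>R v"
      using Suc.prems(3) by (simp only: funpow_Suc_right o_apply)
    then obtain d where "br v (br v y) = d *\<^sub>R v" using Suc.IH[OF vy] by blast
    hence "ip (br v y) (br v y) = 0"
      using ad_v_skew[OF Suc.prems(1) vy(1)] Suc.prems(1,2) v by (simp add: ip_linear)
    thus ?case using null_perp[OF vy] by blast
  qed
  obtain k where k: "\<And>x y. x \<in> V \<Longrightarrow> y \<in> V \<Longrightarrow> (br x ^^ k) y = 0" using ad_nilpotent by metis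
  \<comment> \<open>\<open>step\<close> treats exponents of the form \<open>Suc m\<close>, so one
    extra application is made; the multiple here is 0.\<close>
  have "(br v ^^ Suc k) y = 0 *\<^sub>R v" using k[OF v assms(1)] v by (simp add: br_linear)
  then obtain c where "br v y = c *\<^sub>R v" using step[OF assms] by blast
  thus ?thesis using frame_in vu by (simp add: ip_linear)
qed

text \<open>For \<open>y\<close> orthogonal to \<open>v\<close>, \<open>ad_v_perp\<close> makes
  \<open>v\<close> an eigenvector of the nilpotent map \<open>br y\<close>, so the eigenvalue is
  zero. Skewness then makes \<open>br v u\<close> orthogonal to the whole frame, and nondegeneracy
  kills it.\<close>

lemma v_central:
  assumes x: "x \<in> V"
  shows "br v x = 0" and "br x v = 0"
proof -
  have v: "v \<in> V" and u: "u \<in> V" and v0: "v \<noteq> 0"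
    using frame_in vu by (auto simp: ip_linear)
  have perp: "br v y = 0" if y: "y \<in> V" "ip y v = 0" for y
  proof -
    let ?c = "ip (br v y) u"
    have yv: "br y v = (- ?c) *\<^sub>R v" using ad_v_perp[OF y] br_anti[OF v y(1)] by simp
    have "(br y ^^ j) v = (- ?c) ^ j *\<^sub>R v" for j
      using y(1) v by (induction j) (simp_all add: br_linear yv)
    moreover obtain k where "\<And>x y. x \<in> V \<Longrightarrow> y \<in> V \<Longrightarrow> (br x ^^ k) y = 0"
      using ad_nilpotent by metis
    ultimately have "(- ?c) ^ k *\<^sub>R v = 0" using y(1) v by metis
    hence "?c = 0" using v0 by simp
    thus ?thesis using ad_v_perp[OF y] by simp
  qed
  have "br v u = 0"
  proof (rule ip_nondegenerate)
    show "br v u \<in> V" using u v by (simp add: closed)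
    have uu: "ip (br v u) u = 0"
      using ad_v_skew[OF u u] ip_sym[OF u br_closed[OF v u]] by simp
    have "ip (br v u) e = 0" if e: "e \<in> E" for e
      using ad_v_skew[OF u E_in[OF e]] perp[OF E_in[OF e] Ev[OF e]] u by (simp add: ip_linear)
    thus "\<forall>y\<in>V. ip (br v u) y = 0"
      using uu br_perp[OF v u] ip_expansion[OF br_closed[OF v u]] by simp
  qed
  moreover have "br v (x - ip x v *\<^sub>R u) = 0"
    using x u v by (intro perp) (simp_all add: closed ip_linear uv)
  ultimately show "br v x = 0" using x u v by (simp add: closed br_linear)
  thus "br x v = 0" using br_anti[OF v x] by simp
qed

section \<open>Traces over the Euclidean part of the frame\<close>

lemma nabla_v: "x \<in> V \<Longrightarrow> nabla v x = 0"
  using nabla_torsion[of v x] v_central parallel frame_in by simp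

lemma expansion_perp:
  assumes "x \<in> V" "ip x v = 0"
  shows "x = ip x u *\<^sub>R v + (\<Sum>e\<in>E. ip x e *\<^sub>R e)"
  using expansion[OF assms(1)] assms(2) by simp

text \<open>The \<open>v\<close>-component is annihilated by \<open>h\<close> and there is no
  \<open>u\<close>-component. This serves the bracket and the connection, which both vanish when one
  argument is \<open>v\<close>.\<close>

lemma bilinear_from_expansion_perp:
  fixes h :: "'a \<Rightarrow> 'a \<Rightarrow> 'b::real_vector"
  assumes h: "bilinear_from V h" "h v z = 0" "h z v = 0"
    and x: "x \<in> V" "ip x v = 0" and z: "z \<in> V"
  shows "h x z = (\<Sum>e\<in>E. ip x e *\<^sub>R h e z)" and "h z x = (\<Sum>e\<in>E. ip x e *\<^sub>R h z e)"
proof -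
  let ?s = "\<Sum>e\<in>E. ip x e *\<^sub>R e"
  have s: "?s \<in> V" using E_in by (intro subspace_sum[OF subspace_V]) (simp add: closed)
  have "h x z = h (ip x u *\<^sub>R v + ?s) z" "h z x = h z (ip x u *\<^sub>R v + ?s)"
    using expansion_perp[OF x] by simp_all
  moreover have "h (ip x u *\<^sub>R v + ?s) z = h ?s z" "h z (ip x u *\<^sub>R v + ?s) = h z ?s"
    using s z frame_in h
    by (simp_all add: closed bilinear_from_add[OF h(1)] bilinear_from_scale[OF h(1)])
  ultimately show "h x z = (\<Sum>e\<in>E. ip x e *\<^sub>R h e z)" "h z x = (\<Sum>e\<in>E. ip x e *\<^sub>R h z e)"
    using bilinear_from_sum[OF subspace_V h(1) finite_E E_in z, where c = "ip x"] by simp_all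
qed

text \<open>The trace of the nilpotent map \<open>br z\<close> vanishes, and \<open>u\<close> and
  \<open>v\<close> contribute nothing to it: brackets are orthogonal to \<open>v\<close>, and
  \<open>v\<close> is central.\<close>

lemma unimodular_E:
  assumes z: "z \<in> V"
  shows "(\<Sum>k\<in>E. ip (br z k) k) = 0"
proof -
  obtain k where "\<And>x y. x \<in> V \<Longrightarrow> y \<in> V \<Longrightarrow> (br x ^^ k) y = 0" using ad_nilpotent by metis
  hence "trace_on V (br z) = 0" by (intro trace_on_nilpotent[OF fin_dim ad_endo]) (use z in auto)
  thus ?thesis
    using z frame_in by (simp add: trace_frame[OF ad_endo] br_perp v_central ip_linear)
qed

text \<open>The square of \<open>br i\<close> is again nilpotent, hence traceless; expanding the
  inner bracket over \<open>E\<close> turns its trace into the double sum.\<close>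

lemma killing_E:
  assumes i: "i \<in> V"
  shows "(\<Sum>j\<in>E. \<Sum>k\<in>E. ip (br i j) k * ip (br i k) j) = 0"
proof -
  obtain k where k: "\<And>x y. x \<in> V \<Longrightarrow> y \<in> V \<Longrightarrow> (br x ^^ k) y = 0" using ad_nilpotent by metis
  have endo: "endo V (br i \<circ> br i)"
    using i by (auto simp: endo_def linear_from_def closed br_linear)
  have "((br i \<circ> br i) ^^ k) y = 0" if y: "y \<in> V" for y
  proof -
    have "((br i \<circ> br i) ^^ k) y = ((br i ^^ 2) ^^ k) y" by (simp add: numeral_2_eq_2)
    also have "\<dots> = (br i ^^ (k + k)) y" by (simp add: funpow_mult mult_2)
    also have "\<dots> = (br i ^^ k) ((br i ^^ k) y)" by (simp add: funpow_add)
    also have "\<dots> = 0" using k i y by (simp add: closed)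
    finally show ?thesis .
  qed
  hence "trace_on V (br i \<circ> br i) = 0" by (rule trace_on_nilpotent[OF fin_dim endo])
  hence 0: "(\<Sum>j\<in>E. ip (br i (br i j)) j) = 0"
    using i frame_in by (simp add: trace_frame[OF endo] br_perp v_central br_linear ip_linear closed)
  have "ip (br i (br i j)) j = (\<Sum>k\<in>E. ip (br i j) k * ip (br i k) j)" if j: "j \<in> E" for j
  proof -
    have "br i (br i j) = (\<Sum>k\<in>E. ip (br i j) k *\<^sub>R br i k)"
      by (rule bilinear_from_expansion_perp(2)[OF br_bilinear])
        (use i E_in[OF j] in \<open>auto simp: v_central br_perp closed\<close>)
    moreover have "br i e \<in> V" if "e \<in> E" for e using i E_in[OF that] by (rule br_closed)
    ultimately show ?thesis
      using bilinear_from_sum(1)[OF subspace_V ip_bilinear finite_E _ E_in[OF j],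
        where c = "ip (br i j)" and b = "br i"] by simp
  qed
  thus ?thesis using 0 by simp
qed

lemma ip_perp:
  assumes "x \<in> V" "y \<in> V" "ip x v = 0" "ip y v = 0"
  shows "ip x y = (\<Sum>e\<in>E. ip x e * ip y e)"
  using ip_expansion[OF assms(1,2)] assms(3,4) by simp

text \<open>The summand of \<open>v\<close> vanishes because \<open>nabla v\<close> and
  \<open>br v\<close> do; that of \<open>u\<close> because derivatives are orthogonal to
  \<open>v\<close>.\<close>

lemma ric_trace_E:
  assumes k: "k \<in> V" "ip k v = 0"
  shows "ric k k = (\<Sum>i\<in>E. ip (R i k k) i)"
proof -
  have "R v k k = 0"
    using k frame_in by (simp add: curvature_def nabla_v v_central nabla_linear closed)
  moreover have "ip (R u k k) v = 0"
    using k frame_in by (simp add: curvature_def nabla_perp closed ip_linear)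
  ultimately show ?thesis
    using trace_frame[OF R_endo[OF k(1,1)]] frame_in by (simp add: ricci_tensor_def ip_linear)
qed

text \<open>Skewness moves the outer derivatives onto \<open>i\<close>, after which all pairings
  expand over \<open>E\<close>. The result is the summand in the hypothesis \<open>scal\<close> of
  \<open>structure_constants_eq_0\<close>.\<close>

lemma sectional_E:
  assumes i: "i \<in> E" and k: "k \<in> E"
  shows "ip (R i k k) i = (\<Sum>l\<in>E. ip (nabla i k) l * ip (nabla k i) l
    - ip (nabla k k) l * ip (nabla i i) l - ip (br i k) l * ip (nabla l k) i)"
proof -
  have V: "i \<in> V" "k \<in> V" using E_in i k by auto
  have "nabla (br i k) k = (\<Sum>l\<in>E. ip (br i k) l *\<^sub>R nabla l k)"
    by (rule bilinear_from_expansion_perp(1)[OF nabla_bilinear])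
      (use V in \<open>auto simp: nabla_v parallel br_perp closed\<close>)
  moreover have "nabla l k \<in> V" if "l \<in> E" for l using V E_in[OF that] by (simp add: closed)
  ultimately have "ip (nabla (br i k) k) i = (\<Sum>l\<in>E. ip (br i k) l * ip (nabla l k) i)"
    using bilinear_from_sum(1)[OF subspace_V ip_bilinear finite_E _ V(1),
      where c = "ip (br i k)" and b = "\<lambda>l. nabla l k"] by simp
  moreover have "ip (R i k k) i
    = - ip (nabla k k) (nabla i i) + ip (nabla i k) (nabla k i) - ip (nabla (br i k) k) i"
    using V nabla_skew[of i "nabla k k" i] nabla_skew[of k "nabla i k" i]
    by (simp add: curvature_def closed ip_linear)
  ultimately show ?thesis
    using V by (simp add: ip_perp[of "nabla _ _" "nabla _ _"] nabla_perp closed sum_subtractf)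
qed

text \<open>These are the structure constants of the quotient of the complement of \<open>v\<close>
  by the line of \<open>v\<close>; summing \<open>ric_E\<close> makes the scalar curvature of that
  quotient zero.\<close>

lemma br_E:
  assumes "i \<in> E" "j \<in> E" "k \<in> E"
  shows "ip (br i j) k = 0"
proof (rule structure_constants_eq_0[where c = "\<lambda>i j k. ip (br i j) k"
      and g = "\<lambda>i j k. ip (nabla i j) k", OF finite_E _ _ _ _ _ assms])
  show "ip (br j i) k = - ip (br i j) k" if "i \<in> E" "j \<in> E" "k \<in> E" for i j k
    using that E_in br_anti[of i j] by (simp add: ip_linear closed)
  show "(\<Sum>k\<in>E. ip (br l k) k) = 0" if "l \<in> E" for l
    using unimodular_E E_in that by blast
  show "(\<Sum>j\<in>E. \<Sum>k\<in>E. ip (br i j) k * ip (br i k) j) = 0" if "i \<in> E" for i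
    using killing_E E_in that by blast
  show "2 * ip (nabla i j) k = ip (br i j) k + ip (br k i) j + ip (br k j) i"
    if "i \<in> E" "j \<in> E" "k \<in> E" for i j k
    using that E_in ip_sym[of i "br k j"] by (simp add: ip_nabla closed)
  have "(\<Sum>k\<in>E. \<Sum>i\<in>E. ip (R i k k) i) = 0"
    using ric_E ric_trace_E[OF E_in Ev] by simp
  hence "(\<Sum>i\<in>E. \<Sum>k\<in>E. ip (R i k k) i) = 0" by (subst sum.swap)
  thus "(\<Sum>i\<in>E. \<Sum>k\<in>E. \<Sum>l\<in>E. ip (nabla i k) l * ip (nabla k i) l
    - ip (nabla k k) l * ip (nabla i i) l - ip (br i k) l * ip (nabla l k) i) = 0"
    by (simp add: sectional_E)
qed

lemma br_perp_perp:
  assumes "x \<in> V" "y \<in> V" "ip x v = 0" "ip y v = 0"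
  shows "br x y = ip (br x y) u *\<^sub>R v"
proof -
  have "ip (br x y) e = 0" if e: "e \<in> E" for e
  proof -
    have fe: "bilinear_from V (\<lambda>x y. ip (br x y) e)"
      using E_in[OF e]
      by (auto simp: bilinear_from_def linear_from_def closed br_linear ip_linear)
    note ex = bilinear_from_expansion_perp[OF fe]
    have "ip (br i y) e = 0" if i: "i \<in> E" for i
      using ex(2)[of i y] assms br_E[OF i _ e] E_in[OF i] E_in[OF e]
      by (simp add: v_central ip_linear)
    thus ?thesis using ex(1)[of y x] assms E_in[OF e] by (simp add: v_central ip_linear)
  qed
  thus ?thesis using expansion_perp[of "br x y"] assms by (simp add: closed br_perp)
qed

section \<open>The Euclidean complement and the double extension\<close>

definition transversal :: "'a set" where
  "transversal = {x \<in> V. ip x u = 0 \<and> ip x v = 0}"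

lemma transversal_expansion: "x \<in> transversal \<Longrightarrow> x = (\<Sum>e\<in>E. ip x e *\<^sub>R e)"
  using expansion[of x] by (simp add: transversal_def)

lemma E_transversal: "E \<subseteq> transversal"
  by (auto simp: transversal_def E_in Eu Ev)

lemma subspace_transversal: "subspace transversal"
  using frame_in by (auto simp: transversal_def subspace_def closed ip_linear)

lemma transversal_projection:
  "x \<in> V \<Longrightarrow> x - ip x v *\<^sub>R u - ip x u *\<^sub>R v \<in> transversal"
  using frame_in by (simp add: transversal_def closed ip_linear u_null v_null uv vu)

lemma transversal_euclidean: "euclidean_form transversal ip"
  unfolding euclidean_form_def
proof (intro ballI impI)
  fix x assume x: "x \<in> transversal" "x \<noteq> 0"
  hence "ip x x = (\<Sum>e\<in>E. (ip x e)\<^sup>2)"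
    by (simp add: ip_perp transversal_def power2_eq_square)
  moreover have "(\<Sum>e\<in>E. (ip x e)\<^sup>2) \<noteq> 0"
  proof
    assume "(\<Sum>e\<in>E. (ip x e)\<^sup>2) = 0"
    hence "\<forall>e\<in>E. ip x e = 0" using finite_E by (simp add: sum_nonneg_eq_0_iff)
    thus False using transversal_expansion[OF x(1)] x(2) by simp
  qed
  moreover have "(\<Sum>e\<in>E. (ip x e)\<^sup>2) \<ge> 0" by (simp add: sum_nonneg)
  ultimately show "ip x x > 0" by linarith
qed

text \<open>The bracket is taken to be zero although \<open>br\<close> may leave this subspace: the
  component of \<open>br e e'\<close> along \<open>v\<close> is recorded by \<open>K\<close> in the
  double extension.\<close>

lemma transversal_metric: "metric_lie_algebra transversal (\<lambda>_ _. 0) ip"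
proof
  have "x \<in> span E" if "x \<in> transversal" for x
    by (subst transversal_expansion[OF that]) (intro span_sum span_scale span_base)
  hence "transversal = span E"
    using span_minimal[OF E_transversal subspace_transversal] by blast
  thus "fin_dim_space transversal" using finite_E by (auto simp: fin_dim_space_def)
  show "bilinear_from transversal ip"
    using ip_bilinear by (auto simp: bilinear_from_def linear_from_def transversal_def)
  show "ip x y = ip y x" if "x \<in> transversal" "y \<in> transversal" for x y
    using that ip_sym by (simp add: transversal_def)
  show "x = 0" if "x \<in> transversal" "\<forall>y\<in>transversal. ip x y = 0" for x
    using that transversal_euclidean unfolding euclidean_form_def by force
qed (auto simp: bilinear_from_def linear_from_def subspace_0[OF subspace_transversal])

text \<open>An explicit Riesz representation in the orthonormal set \<open>E\<close>, used to turn
  the \<open>v\<close>-coefficients of brackets into \<open>L\<close> and \<open>K\<close>.\<close>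

lemma functional_represented:
  assumes e: "e \<in> transversal" and f: "linear_from V f"
  shows "ip (\<Sum>k\<in>E. f k *\<^sub>R k) e = f e"
proof -
  have eV: "e \<in> V" using e by (simp add: transversal_def)
  have "ip (\<Sum>k\<in>E. f k *\<^sub>R k) e = (\<Sum>k\<in>E. f k *\<^sub>R ip k e)"
    by (rule bilinear_from_sum(1)[OF subspace_V ip_bilinear finite_E E_in eV])
  also have "\<dots> = (\<Sum>k\<in>E. ip e k *\<^sub>R f k)"
    using ip_sym[OF eV E_in] by (intro sum.cong) auto
  also have "\<dots> = f (\<Sum>k\<in>E. ip e k *\<^sub>R k)"
    by (rule linear_from_sum[OF subspace_V f finite_E E_in, symmetric])
  finally show ?thesis using transversal_expansion[OF e] by simp
qed

lemma double_extension_transversal: "double_extension V br ip transversal (\<lambda>_ _. 0) ip"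
proof -
  \<comment> \<open>The coefficient of \<open>v\<close> in a bracket is its pairing with
    \<open>u\<close>. Removing it from \<open>br u e\<close> leaves \<open>D\<close>;
    \<open>L\<close> and \<open>K\<close> represent it for \<open>br u e\<close> and
    \<open>br e e'\<close>.\<close>
  define D where "D e = br u e - ip (br u e) u *\<^sub>R v" for e
  define K where "K e = (\<Sum>k\<in>E. ip (br e k) u *\<^sub>R k)" for e
  define L where "L = (\<Sum>k\<in>E. ip (br u k) u *\<^sub>R k)"
  have W: "x \<in> V" "ip x u = 0" "ip x v = 0" if "x \<in> transversal" for x
    using that by (auto simp: transversal_def)
  have sumW: "(\<Sum>k\<in>E. f k *\<^sub>R k) \<in> transversal" for f
    using E_transversal by (intro subspace_sum subspace_transversal subspace_scale) auto
  have "D e \<in> transversal" if "e \<in> transversal" for e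
    using transversal_projection[of "br u e"] W(1)[OF that] frame_in
    by (simp add: D_def br_perp closed)
  hence D: "endo transversal D"
    using W frame_in
    by (auto simp: endo_def linear_from_def D_def br_linear ip_linear closed algebra_simps)
  have K: "endo transversal K"
    using W frame_in E_in sumW
    by (auto simp: endo_def linear_from_def K_def br_linear ip_linear closed scaleR_left_distrib
      sum.distrib scaleR_sum_right)
  have lin: "linear_from V (\<lambda>y. ip (br x y) u)" if "x \<in> V" for x
    using that frame_in by (auto simp: linear_from_def br_linear ip_linear closed)
  have ue: "br u e = D e + ip L e *\<^sub>R v" if "e \<in> transversal" for e
    using functional_represented[OF that lin[of u]] frame_in by (simp add: D_def L_def)
  have ee: "br e e' = 0 + ip (K e) e' *\<^sub>R v" if "e \<in> transversal" "e' \<in> transversal" for e e'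
    using functional_represented[OF that(2) lin[of e]] br_perp_perp[of e e'] W that
    by (simp add: K_def)
  have "bij_betw (\<lambda>(a, b, e). a *\<^sub>R u + b *\<^sub>R v + e) (UNIV \<times> UNIV \<times> transversal) V"
  proof (rule bij_betw_byWitness[where f' = "\<lambda>x. (ip x v, ip x u, x - ip x v *\<^sub>R u - ip x u *\<^sub>R v)"])
    show "\<forall>x\<in>UNIV \<times> UNIV \<times> transversal.
      (\<lambda>x. (ip x v, ip x u, x - ip x v *\<^sub>R u - ip x u *\<^sub>R v))
        ((\<lambda>(a, b, e). a *\<^sub>R u + b *\<^sub>R v + e) x) = x"
      using W frame_in by (auto simp: closed ip_linear u_null v_null uv vu)
    show "(\<lambda>(a, b, e). a *\<^sub>R u + b *\<^sub>R v + e) ` (UNIV \<times> UNIV \<times> transversal) \<subseteq> V"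
      using W frame_in by (auto simp: closed)
    show "(\<lambda>x. (ip x v, ip x u, x - ip x v *\<^sub>R u - ip x u *\<^sub>R v)) ` V
      \<subseteq> UNIV \<times> UNIV \<times> transversal"
      using transversal_projection by auto
  qed auto
  moreover have "\<forall>e\<in>transversal. ip u e = 0 \<and> ip v e = 0"
    using W ip_sym frame_in by metis
  moreover have "L \<in> transversal" unfolding L_def by (rule sumW)
  ultimately show ?thesis
    unfolding double_extension_def
    using metric_lie_algebra_axioms transversal_metric D K ue ee v_central(2) uv u_null v_null
    by blast
qed

end

section \<open>The Ricci tensor of type II and its null direction\<close>

lemma (in metric_lie_algebra) type_II_ricci:
  assumes lor: "lorentz_form V ip" and II: "type_II V br ip"
  obtains v c where "v \<in> V" "v \<noteq> 0" "ip v v = 0" "c \<noteq> 0"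
    "\<And>x y. x \<in> V \<Longrightarrow> y \<in> V \<Longrightarrow> ric x y = c * ip x v * ip y v"
proof -
  have sym: "ric x y = ric y x" if "x \<in> V" "y \<in> V" for x y
    using lor that ric_sym by (auto simp: lorentz_form_def)
  \<comment> \<open>Self-adjointness turns the pairing into one with \<open>Ric (Ric y)\<close>,
    which is zero by type II.\<close>
  have isotropic: "ip (Ric x) (Ric y) = 0" if "x \<in> V" "y \<in> V" for x y
  proof -
    have "ip (Ric x) (Ric y) = ip (Ric (Ric y)) x"
      using that sym[of x "Ric y"] by (simp add: ip_Ric Ric_closed)
    also have "Ric (Ric y) = 0" using II that by (simp add: type_II_def)
    finally show ?thesis using that by (simp add: ip_linear)
  qed
  obtain x0 where x0: "x0 \<in> V" "Ric x0 \<noteq> 0" using II by (auto simp: type_II_def)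
  define v where "v = Ric x0"
  have v: "v \<in> V" "v \<noteq> 0" "ip v v = 0" using x0 isotropic by (auto simp: v_def Ric_closed)
  obtain u E where "null_frame V br ip u v E" using null_frame_exists[OF lor v] .
  then interpret null_frame V br ip u v E .
  \<comment> \<open>Every value of \<open>Ric\<close> is null and orthogonal to the value
    \<open>v\<close>, so \<open>null_perp\<close> places it on the line of \<open>v\<close>.\<close>
  have Ric: "Ric x = ip (Ric x) u *\<^sub>R v" if "x \<in> V" for x
    by (rule null_perp) (use that x0 isotropic in \<open>auto simp: v_def Ric_closed\<close>)
  define c where "c = ip (Ric u) u"
  have r: "ric x y = ip (Ric x) u * ip y v" if "x \<in> V" "y \<in> V" for x y
  proof -
    have "ric x y = ip (ip (Ric x) u *\<^sub>R v) y" using that Ric[of x] ip_Ric[of x y] by simp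
    thus ?thesis using that v ip_sym[of v y] by (simp add: ip_linear)
  qed
  \<comment> \<open>Comparing \<open>ric x u\<close> with \<open>ric u x\<close> determines the
    coefficient of \<open>Ric x\<close> along \<open>v\<close> as \<open>c * ip x v\<close>.\<close>
  have ric: "ric x y = c * ip x v * ip y v" if xy: "x \<in> V" "y \<in> V" for x y
    using r[OF xy] r[OF xy(1) frame_in(1)] r[OF frame_in(1) xy(1)] sym[OF xy(1) frame_in(1)] uv
    by (simp add: c_def)
  \<comment> \<open>With \<open>c = 0\<close> the vector \<open>v\<close>, a value of
    \<open>Ric\<close>, would be orthogonal to all of \<open>V\<close>, although it pairs to 1 with
    \<open>u\<close>.\<close>
  have "c \<noteq> 0"
  proof
    assume "c = 0"
    hence "ip v y = 0" if "y \<in> V" for y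
      using ip_Ric[OF x0(1) that] ric[OF x0(1) that] by (simp add: v_def)
    thus False using vu frame_in by simp
  qed
  thus thesis using that v ric by blast
qed

theorem theorem1p4:
  fixes V :: "'a::real_vector set"
    and br :: "'a \<Rightarrow> 'a \<Rightarrow> 'a"
    and ip :: "'a \<Rightarrow> 'a \<Rightarrow> real"
  assumes "metric_lie_algebra V br ip"
    and "nilpotent_lie V br"
    and "lorentz_form V ip"
    and "ricci_parallel V br ip"
    and "type_II V br ip"
  shows "\<exists>V0 br0 ip0. metric_lie_algebra V0 br0 ip0 \<and> abelian_lie V0 br0 \<and>
           euclidean_form V0 ip0 \<and> double_extension V br ip V0 br0 ip0"
proof -
  interpret metric_lie_algebra V br ip by fact
  obtain v c where v: "v \<in> V" "v \<noteq> 0" "ip v v = 0" and c: "c \<noteq> 0"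
    and ric: "\<And>x y. x \<in> V \<Longrightarrow> y \<in> V \<Longrightarrow> ric x y = c * ip x v * ip y v"
    using type_II_ricci[OF assms(3,5)] by metis
  obtain u E where "null_frame V br ip u v E" using null_frame_exists[OF assms(3) v] .
  then interpret null_frame V br ip u v E .
  have par: "ip (nabla x y) v * ip z v + ip y v * ip (nabla x z) v = 0"
    if "x \<in> V" "y \<in> V" "z \<in> V" for x y z
  proof -
    have "c * (ip (nabla x y) v * ip z v + ip y v * ip (nabla x z) v) = 0"
      using assms(4) that unfolding ricci_parallel_def by (simp add: ric closed algebra_simps)
    thus ?thesis using c by simp
  qed
  have "nabla x v = 0" if x: "x \<in> V" for x
  proof (rule ip_nondegenerate)
    show "nabla x v \<in> V" using x v(1) by (rule closed)
    \<comment> \<open>Setting both arguments to \<open>u\<close> gives twice this pairing; setting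
      one of them to \<open>u\<close> then settles an arbitrary \<open>y\<close>, and skewness
      transfers the result to \<open>nabla x v\<close>.\<close>
    have "ip (nabla x u) v = 0" using par[OF x frame_in(1,1)] uv by simp
    hence "ip (nabla x y) v = 0" if "y \<in> V" for y using par[OF x that frame_in(1)] uv by simp
    thus "\<forall>y\<in>V. ip (nabla x v) y = 0"
      using x v(1) nabla_skew[OF x v(1)] ip_sym[OF v(1)] by (simp add: closed)
  qed
  then interpret parallel_null_frame V br ip u v E
    by unfold_locales (use assms(2) ric E_in Ev in auto)
  show ?thesis
    using transversal_metric transversal_euclidean double_extension_transversal
    by (auto simp: abelian_lie_def intro!: exI[of _ transversal] exI[of _ "\<lambda>_ _. 0"] exI[of _ ip])
qed

end
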